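(* Let $d\ge1$ and let $(\mathbb{R}^d,\mathcal{B}(\mathbb{R}^d),\mathbb{P})$ be a probability space. For $N\in\mathbb{N}$ and $i=1,\dots,N$ let $X_i:\mathbb{R}^d\to\mathbb{R}^d$ and $M_i:\mathbb{R}^d\to[0,\infty)$ be random variables such that $(X_i,M_i)$ and $(X_j,M_j)$ are independent for every $i\ne j$. Assume that $\sup_{N\in\mathbb{N}}\max_{1\le i\le N}\mathbb{E}|X_i|^2\le C$ for a constant $C$, and that $$\max_{1\le i\le N}\sup_{x\in\mathbb{R}^d}|M_i(x)|\le M,\qquad \inf_{N\in\mathbb{N}}\min_{1\le i\le N}\mathbb{E}M_i\ge\bar m$$ for some positive constants $\bar m,M>0$. Define $$\mu_N:=\frac1N\sum_{i=1}^NM_i\delta_{X_i},\qquad \nu_N:=\frac1N\sum_{i=1}^N\tilde f_i,\qquad \tilde f_i=X_{i\#}[M_i\,d\mathbb{P}].$$ Then there exists a positive $\bar C=\bar C(M,C,d)$ such that for every $N>\max\{1,\bar m^{-\frac{1}{2+3d/2}}\}$ $$\mathbb{E}\,d_F(\mu_N,\nu_N)\le\bar C(M,C,d)\,N^{-\frac{1}{2+3d/2}}.$$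
   Context: $d_F$ is the flat metric on positive Radon measures on $\mathbb{R}^d$: $d_F(\mu,\nu)=\sup\{|\int_{\mathbb{R}^d}\phi\,d(\mu-\nu)|:\phi\in W^{1,\infty}(\mathbb{R}^d),\ \|\phi\|_{L^\infty}\le1,\ \|\nabla\phi\|_{L^\infty}\le1\}$. $X_{i\#}[M_id\mathbb{P}]$ is the push-forward, i.e. $\tilde f_i(U)=\mathbb{E}(M_i\mathbf{1}_U(X_i))$ for Borel $U$. The random variables may depend on $N$ (this is suppressed in the notation); the bound on $M_i$ is with the same $M$ for all $N$. *)

theory Defs
  imports "HOL-Probability.Probability" "HOL-Probability.Essential_Supremum"
begin

section \<open>Sobolev functions and the flat metric\<close>

definition partial_deriv :: "'a::euclidean_space \<Rightarrow> ('a \<Rightarrow> real) \<Rightarrow> 'a \<Rightarrow> real" where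
  "partial_deriv b f x = frechet_derivative f (at x) b"

primrec C_k :: "nat \<Rightarrow> ('a::euclidean_space \<Rightarrow> real) \<Rightarrow> bool" where
  "C_k 0 f \<longleftrightarrow> continuous_on UNIV f"
| "C_k (Suc k) f \<longleftrightarrow> f differentiable_on UNIV \<and> (\<forall>b\<in>Basis. C_k k (partial_deriv b f))"

text \<open>The space $C_c^\infty$.\<close>
definition test_function :: "('a::euclidean_space \<Rightarrow> real) \<Rightarrow> bool" where
  "test_function \<eta> \<longleftrightarrow> (\<forall>k. C_k k \<eta>) \<and> compact (closure {x. \<eta> x \<noteq> 0})"

definition locally_integrable ::
    "('a::euclidean_space \<Rightarrow> 'b::{banach, second_countable_topology}) \<Rightarrow> bool" where
  "locally_integrable f \<longleftrightarrow> (\<forall>K. compact K \<longrightarrow> set_integrable lborel K f)"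

definition weak_gradient :: "('a::euclidean_space \<Rightarrow> real) \<Rightarrow> ('a \<Rightarrow> 'a) \<Rightarrow> bool" where
  "weak_gradient \<phi> g \<longleftrightarrow> locally_integrable \<phi> \<and> locally_integrable g \<and>
     (\<forall>\<eta>. test_function \<eta> \<longrightarrow> (\<forall>b\<in>Basis.
        (\<integral>x. \<phi> x * partial_deriv b \<eta> x \<partial>lborel) = - (\<integral>x. (g x \<bullet> b) * \<eta> x \<partial>lborel)))"

definition Linf_norm :: "('a::euclidean_space \<Rightarrow> 'b::real_normed_vector) \<Rightarrow> ennreal" where
  "Linf_norm f = esssup lborel (\<lambda>x. ennreal (norm (f x)))"

definition W1inf :: "('a::euclidean_space \<Rightarrow> real) set" where
  "W1inf = {\<phi>. Linf_norm \<phi> < \<infinity> \<and> (\<exists>g. weak_gradient \<phi> g \<and> Linf_norm g < \<infinity>)}"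

text \<open>
  Integrating a class in $W^{1,\infty}$ against a measure that may have atoms requires its
  continuous representative, hence the continuity condition. The weak gradient is determined
  only up to null sets, which does not affect its $L^\infty$ norm. The definition is meant for
  finite Borel measures: there all test functions are integrable, and the integral against
  $\mu - \nu$ is the difference of the two integrals.
\<close>
definition flat_dist :: "'a::euclidean_space measure \<Rightarrow> 'a measure \<Rightarrow> ennreal" where
  "flat_dist \<mu> \<nu> =
     (SUP \<phi>\<in>{\<phi>\<in>W1inf. continuous_on UNIV \<phi> \<and> Linf_norm \<phi> \<le> 1 \<and>
                (\<exists>g. weak_gradient \<phi> g \<and> Linf_norm g \<le> 1)}.
        ennreal \<bar>(\<integral>x. \<phi> x \<partial>\<mu>) - (\<integral>x. \<phi> x \<partial>\<nu>)\<bar>)"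

section \<open>Finite sums of Borel measures\<close>

definition sum_measure :: "'i set \<Rightarrow> ('i \<Rightarrow> 'a::topological_space measure) \<Rightarrow> 'a measure" where
  "sum_measure I \<mu> = measure_of UNIV (sets borel) (\<lambda>A. \<Sum>i\<in>I. emeasure (\<mu> i) A)"

lemma sets_sum_measure [simp, measurable_cong]: "sets (sum_measure I \<mu>) = sets borel"
  unfolding sum_measure_def
  by (metis sets.sets_measure_of_eq space_borel)

lemma emeasure_sum_measure:
  fixes \<mu> :: "'i \<Rightarrow> 'a::topological_space measure"
  assumes "\<And>i. i \<in> I \<Longrightarrow> sets (\<mu> i) = sets borel" and "A \<in> sets borel"
  shows "emeasure (sum_measure I \<mu>) A = (\<Sum>i\<in>I. emeasure (\<mu> i) A)"
proof (rule emeasure_measure_of[OF sum_measure_def])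
  show "sets borel \<subseteq> Pow (UNIV :: 'a set)" by simp
  show "A \<in> sets (sum_measure I \<mu>)" using assms by simp
  show "positive (sets (sum_measure I \<mu>)) (\<lambda>A. \<Sum>i\<in>I. emeasure (\<mu> i) A)"
    by (simp add: positive_def)
  show "countably_additive (sets (sum_measure I \<mu>)) (\<lambda>A. \<Sum>i\<in>I. emeasure (\<mu> i) A)"
    unfolding countably_additive_def
  proof (intro allI impI)
    fix F :: "nat \<Rightarrow> 'a set"
    assume F: "range F \<subseteq> sets (sum_measure I \<mu>)" "disjoint_family F"
    have "(\<Sum>n. \<Sum>i\<in>I. emeasure (\<mu> i) (F n)) = (\<Sum>i\<in>I. \<Sum>n. emeasure (\<mu> i) (F n))"
      by (rule suminf_sum) simp
    also have "\<dots> = (\<Sum>i\<in>I. emeasure (\<mu> i) (\<Union>n. F n))"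
      using F assms(1) by (intro sum.cong refl suminf_emeasure) auto
    finally show "(\<Sum>n. \<Sum>i\<in>I. emeasure (\<mu> i) (F n)) = (\<Sum>i\<in>I. emeasure (\<mu> i) (\<Union>n. F n))" .
  qed
qed

section \<open>The empirical measure and its mean\<close>

definition empirical_measure ::
    "nat \<Rightarrow> (nat \<Rightarrow> 'w \<Rightarrow> 'a::topological_space) \<Rightarrow> (nat \<Rightarrow> 'w \<Rightarrow> real) \<Rightarrow> 'w \<Rightarrow> 'a measure" where
  "empirical_measure N X m \<omega> =
     scale_measure (ennreal (1 / real N))
       (sum_measure {1..N} (\<lambda>i. scale_measure (ennreal (m i \<omega>)) (return borel (X i \<omega>))))"

definition weighted_law ::
    "'w measure \<Rightarrow> ('w \<Rightarrow> 'a::topological_space) \<Rightarrow> ('w \<Rightarrow> real) \<Rightarrow> 'a measure" where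
  "weighted_law P X m = distr (density P (\<lambda>\<omega>. ennreal (m \<omega>))) borel X"

definition mean_measure ::
    "'w measure \<Rightarrow> nat \<Rightarrow> (nat \<Rightarrow> 'w \<Rightarrow> 'a::topological_space) \<Rightarrow> (nat \<Rightarrow> 'w \<Rightarrow> real) \<Rightarrow> 'a measure"
  where
  "mean_measure P N X m =
     scale_measure (ennreal (1 / real N)) (sum_measure {1..N} (\<lambda>i. weighted_law P (X i) (m i)))"

end

theory Submission
  imports Defs "HOL-Computational_Algebra.Polynomial"
begin

text \<open>
  An admissible function of the flat metric is bounded by 1 and, up to a factor depending on the
  dimension, Lipschitz with constant 1. So on a cube of side \<open>\<epsilon>\<close> it is almost constant, and
  the distance of two measures is controlled by the differences of their masses on finitely many
  such cubes, plus the oscillation on a cube, of order \<open>\<epsilon>\<close>, plus the mass outside a large ball. If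
  the ball has radius \<open>\<epsilon> powr (- 1/2)\<close>, the second moments bound that mass by a multiple of \<open>\<epsilon>\<close>,
  and about \<open>\<epsilon> powr (- 3 * d / 2)\<close> cubes are needed. This bound is the same for all admissible
  functions, which is what makes the supremum inside the expectation harmless
  (\<open>integral_difference_le\<close>).

  The mass that the empirical measure gives to one cube is an average of pairwise independent
  variables with values in \<open>[0, M]\<close>, and only its variance is used. The cubes being disjoint,
  the variances over all cubes add up to at most \<open>M\<^sup>2 / N\<close>
  (\<open>second_moment_fluctuations_le\<close>). By Cauchy-Schwarz, here in the form
  \<open>\<bar>z\<bar> \<le> (\<epsilon> * z\<^sup>2 + 1 / \<epsilon>) / 2\<close>, the cubes contribute
  \<open>\<epsilon> + \<epsilon> powr (- 3 * d / 2 - 1) / N\<close> up to constants. The choice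
  \<open>\<epsilon> = N powr (- 1 / (2 + 3 * d / 2))\<close> makes both summands equal to \<open>\<epsilon>\<close>, which is the rate.

  Admissible functions are given by a bound on a weak gradient, so their Lipschitz estimate
  has to be extracted by testing (\<open>weak_gradient_bound_imp_Lipschitz\<close>). The test function for a
  coordinate increment is a product of one-dimensional profiles: a plateau in the direction of the
  increment, whose derivative is the difference of two narrow bumps, and narrow bumps in the other
  directions. Its partial derivative is then a difference of two mollifiers, so that the integration
  by parts compares two local averages of the function.
\<close>

section \<open>Smooth functions of one variable\<close>

text \<open>
  Only the existence of derivatives is recorded: each derivative is differentiable again, so all but
  the last are continuous, and smoothness is the conjunction over all orders.
\<close>
primrec times_differentiable :: "nat \<Rightarrow> (real \<Rightarrow> real) \<Rightarrow> bool" where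
  "times_differentiable 0 f \<longleftrightarrow> True"
| "times_differentiable (Suc k) f \<longleftrightarrow>
     (\<exists>f'. (\<forall>x. (f has_real_derivative f' x) (at x)) \<and> times_differentiable k f')"

definition smooth :: "(real \<Rightarrow> real) \<Rightarrow> bool" where
  "smooth f \<longleftrightarrow> (\<forall>k. times_differentiable k f)"

lemma times_differentiable_SucD: "times_differentiable (Suc k) f \<Longrightarrow> times_differentiable k f"
proof (induction k arbitrary: f)
  case (Suc k)
  then obtain f' where "\<forall>x. (f has_real_derivative f' x) (at x)" "times_differentiable (Suc k) f'"
    by (metis times_differentiable.simps(2))
  with Suc.IH show ?case by auto
qed simp

lemma times_differentiable_add:
  "times_differentiable k f \<Longrightarrow> times_differentiable k g \<Longrightarrow> times_differentiable k (\<lambda>x. f x + g x)"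
proof (induction k arbitrary: f g)
  case (Suc k)
  then obtain f' g' where
    "\<forall>x. (f has_real_derivative f' x) (at x)" "times_differentiable k f'"
    "\<forall>x. (g has_real_derivative g' x) (at x)" "times_differentiable k g'"
    by auto
  with Suc.IH show ?case
    by (auto intro!: exI[of _ "\<lambda>x. f' x + g' x"] derivative_intros)
qed simp

lemma times_differentiable_mult:
  "times_differentiable k f \<Longrightarrow> times_differentiable k g \<Longrightarrow> times_differentiable k (\<lambda>x. f x * g x)"
proof (induction k arbitrary: f g)
  case (Suc k)
  then obtain f' g' where d:
    "\<forall>x. (f has_real_derivative f' x) (at x)" "times_differentiable k f'"
    "\<forall>x. (g has_real_derivative g' x) (at x)" "times_differentiable k g'"
    by auto
  have "times_differentiable k (\<lambda>x. f' x * g x + f x * g' x)"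
    using d by (intro times_differentiable_add Suc.IH times_differentiable_SucD[OF Suc.prems(1)]
        times_differentiable_SucD[OF Suc.prems(2)])
  moreover have "((\<lambda>x. f x * g x) has_real_derivative f' x * g x + f x * g' x) (at x)" for x
    using d by (auto intro!: derivative_eq_intros)
  ultimately show ?case
    by (auto intro!: exI[of _ "\<lambda>x. f' x * g x + f x * g' x"])
qed simp

lemma times_differentiable_const: "times_differentiable k (\<lambda>x. c)"
  by (induction k arbitrary: c) (auto intro!: exI[of _ "\<lambda>x. 0"] derivative_eq_intros)

lemma times_differentiable_affine:
  "times_differentiable k f \<Longrightarrow> times_differentiable k (\<lambda>x. f (a * x + b))"
proof (induction k arbitrary: f)
  case (Suc k)
  then obtain f' where f': "\<forall>x. (f has_real_derivative f' x) (at x)" "times_differentiable k f'"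
    by auto
  have "((\<lambda>x. f (a * x + b)) has_real_derivative f' (a * x + b) * a) (at x)" for x
    using f' by (auto intro!: derivative_eq_intros DERIV_chain2[of f])
  moreover have "times_differentiable k (\<lambda>x. f' (a * x + b) * a)"
    by (intro times_differentiable_mult times_differentiable_const Suc.IH f')
  ultimately show ?case
    by (auto intro!: exI[of _ "\<lambda>x. f' (a * x + b) * a"])
qed simp

lemma smooth_add: "smooth f \<Longrightarrow> smooth g \<Longrightarrow> smooth (\<lambda>x. f x + g x)"
  and smooth_mult: "smooth f \<Longrightarrow> smooth g \<Longrightarrow> smooth (\<lambda>x. f x * g x)"
  and smooth_const: "smooth (\<lambda>x. c)"
  and smooth_affine: "smooth f \<Longrightarrow> smooth (\<lambda>x. f (a * x + b))"
  by (auto simp: smooth_def times_differentiable_add times_differentiable_mult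
      times_differentiable_const times_differentiable_affine)

text \<open>
  Lets a smooth step be defined as an antiderivative of a smooth bump.
\<close>
lemma smooth_antiderivative:
  assumes "smooth f" "\<And>x. (F has_real_derivative f x) (at x)"
  shows "smooth F"
  unfolding smooth_def
proof
  fix k show "times_differentiable k F"
    using assms by (cases k) (auto simp: smooth_def)
qed

lemma smooth_imp_isCont:
  assumes "smooth f" shows "isCont f x"
proof -
  have "times_differentiable (Suc 0) f" using assms by (auto simp: smooth_def)
  then show ?thesis by (auto intro: DERIV_isCont)
qed

lemma smooth_borel_measurable [measurable (raw)]: "smooth f \<Longrightarrow> f \<in> borel_measurable borel"
  by (intro borel_measurable_continuous_onI continuous_at_imp_continuous_on)
     (auto intro: smooth_imp_isCont)

text \<open>
  The functions \<open>q(1/x) * exp (- 1/x)\<close>, extended by zero, form a family that contains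
  \<open>exp (- 1/x)\<close> and is closed under differentiation; this makes the smoothness proof a plain induction.
\<close>
definition flat_exp :: "real poly \<Rightarrow> real \<Rightarrow> real" where
  "flat_exp p x = (if x > 0 then poly p (1 / x) * exp (- (1 / x)) else 0)"

lemma poly_mult_exp_neg_tendsto_0:
  fixes p :: "real poly"
  shows "((\<lambda>u. poly p u * exp (- u)) \<longlongrightarrow> 0) at_top"
proof -
  have "((\<lambda>u. u ^ k * (poly p u * exp (- u))) \<longlongrightarrow> 0) at_top" for k
  proof (induction p arbitrary: k)
    case (pCons a p)
    have "((\<lambda>u::real. a * (u ^ k / exp u) + u ^ Suc k * (poly p u * exp (- u))) \<longlongrightarrow> a * 0 + 0) at_top"
      by (intro tendsto_add tendsto_mult_left tendsto_power_div_exp_0 pCons.IH)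
    then show ?case
      by (simp add: algebra_simps exp_minus divide_inverse)
  qed simp
  from this[of 0] show ?thesis by simp
qed

text \<open>
  For \<open>x > 0\<close> and \<open>u = 1/x\<close> the product and chain rules turn \<open>p(u) * exp (- u)\<close> into
  \<open>u\<^sup>2 * (p(u) - p'(u)) * exp (- u)\<close>. At the origin the difference quotient from the right is
  \<open>u * p(u) * exp (- u)\<close>, which vanishes as \<open>u\<close> tends to infinity.
\<close>
lemma flat_exp_has_derivative:
  "(flat_exp p has_real_derivative flat_exp ([:0, 0, 1:] * (p - pderiv p)) x) (at x)"
proof -
  consider "x > 0" | "x < 0" | "x = 0" by linarith
  then show ?thesis
  proof cases
    case 1
    have "((\<lambda>x. poly p (1 / x) * exp (- (1 / x))) has_real_derivative
        flat_exp ([:0, 0, 1:] * (p - pderiv p)) x) (at x)"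
      using 1 by (auto intro!: derivative_eq_intros DERIV_chain2[OF poly_DERIV]
          simp: flat_exp_def field_simps power2_eq_square)
    then show ?thesis
      by (rule has_field_derivative_transform_within_open[of _ _ _ "{0<..}"])
         (use 1 in \<open>auto simp: flat_exp_def\<close>)
  next
    case 2
    have "((\<lambda>x. 0) has_real_derivative flat_exp ([:0, 0, 1:] * (p - pderiv p)) x) (at x)"
      using 2 by (auto simp: flat_exp_def)
    then show ?thesis
      by (rule has_field_derivative_transform_within_open[of _ _ _ "{..<0}"])
         (use 2 in \<open>auto simp: flat_exp_def\<close>)
  next
    case 3
    have "((\<lambda>h. poly ([:0, 1:] * p) (inverse h) * exp (- inverse h)) \<longlongrightarrow> 0) (at_right 0)"
      by (rule filterlim_compose[OF poly_mult_exp_neg_tendsto_0 filterlim_inverse_at_top_right])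
    then have "((\<lambda>h. (flat_exp p (0 + h) - flat_exp p 0) / h) \<longlongrightarrow> 0) (at_right 0)"
      by (rule Lim_transform_eventually)
         (auto simp: eventually_at_filter flat_exp_def field_simps)
    moreover have "((\<lambda>h. (flat_exp p (0 + h) - flat_exp p 0) / h) \<longlongrightarrow> 0) (at_left 0)"
      by (rule Lim_transform_eventually[OF tendsto_const])
         (auto simp: eventually_at_filter flat_exp_def)
    ultimately show ?thesis
      unfolding 3 DERIV_def by (auto intro!: filterlim_split_at simp: flat_exp_def)
  qed
qed

lemma smooth_flat_exp: "smooth (flat_exp p)"
proof -
  have "times_differentiable k (flat_exp p)" for k
    by (induction k arbitrary: p) (auto intro: flat_exp_has_derivative)
  then show ?thesis by (simp add: smooth_def)
qed

text \<open>
  The product \<open>exp (- 1/s) * exp (- 1/(\<delta> - s))\<close>, extended by zero outside \<open>(0, \<delta>)\<close>, is a smooth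
  bump; its antiderivative, normalised to rise from 0 to 1, is the step.
\<close>
lemma smooth_step_exists:
  fixes \<delta> :: real
  assumes "\<delta> > 0"
  obtains \<Psi> \<psi> where "smooth \<Psi>" "smooth \<psi>" "\<And>s. (\<Psi> has_real_derivative \<psi> s) (at s)"
    "\<And>s. 0 \<le> \<psi> s" "\<And>s. s \<le> 0 \<Longrightarrow> \<psi> s = 0" "\<And>s. s \<ge> \<delta> \<Longrightarrow> \<psi> s = 0"
    "\<And>s. s \<le> 0 \<Longrightarrow> \<Psi> s = 0" "\<And>s. s \<ge> \<delta> \<Longrightarrow> \<Psi> s = 1"
proof -
  define f where "f s = flat_exp 1 s * flat_exp 1 (-1 * s + \<delta>)" for s
  have f: "smooth f"
    unfolding f_def by (intro smooth_mult smooth_affine smooth_flat_exp)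
  have f_pos: "f s > 0" if "0 < s" "s < \<delta>" for s
    using that by (auto simp: f_def flat_exp_def)
  have f_nonneg: "f s \<ge> 0" and f_left: "s \<le> 0 \<Longrightarrow> f s = 0" and f_right: "s \<ge> \<delta> \<Longrightarrow> f s = 0" for s
    by (auto simp: f_def flat_exp_def)
  have "\<exists>F. \<forall>x. -\<infinity> < ereal x \<longrightarrow> ereal x < \<infinity> \<longrightarrow> (F has_vector_derivative f x) (at x)"
    using smooth_imp_isCont[OF f] by (intro einterval_antiderivative) auto
  then obtain F where F: "(F has_real_derivative f x) (at x)" for x
    by (auto simp: has_real_derivative_iff_has_vector_derivative)
  define c where "c = F \<delta> - F 0"
  have "F 0 < F \<delta>"
    using assms F f_pos DERIV_pos_imp_increasing_open[of 0 \<delta> F] 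
    by (meson DERIV_isCont continuous_at_imp_continuous_on)
  then have c: "c > 0" by (simp add: c_def)
  have F_left: "F s = F 0" if "s \<le> 0" for s
  proof (cases "s = 0")
    case False
    have "F 0 = F s"
      by (rule DERIV_isconst_end[of s 0 F])
         (use False that F f_left in \<open>auto intro!: continuous_at_imp_continuous_on DERIV_isCont, metis less_imp_le\<close>)
    then show ?thesis by simp
  qed simp
  have F_right: "F s = F \<delta>" if "s \<ge> \<delta>" for s
  proof (cases "s = \<delta>")
    case False
    show ?thesis
      by (rule DERIV_isconst_end[of \<delta> s F])
         (use False that F f_right in \<open>auto intro!: continuous_at_imp_continuous_on DERIV_isCont, metis less_imp_le\<close>)
  qed simp
  have deriv: "((\<lambda>s. (F s + - F 0) * (1 / c)) has_real_derivative f s * (1 / c)) (at s)" for s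
  proof -
    have "((\<lambda>s. F s + - F 0) has_real_derivative f s + 0) (at s)"
      by (intro DERIV_add F DERIV_const)
    from DERIV_cmult_right[OF this, of "1 / c"] show ?thesis by (simp only: add_0_right)
  qed
  have step: "(F s + - F 0) * (1 / c) = 1" if "s \<ge> \<delta>" for s
    using c F_right[OF that] by (simp add: c_def)
  have zero: "(F s + - F 0) * (1 / c) = 0" if "s \<le> 0" for s
    using F_left[OF that] by simp
  have psi: "smooth (\<lambda>s. f s * (1 / c))"
    by (intro smooth_mult smooth_const f)
  show ?thesis
    by (rule that[OF smooth_antiderivative[OF psi deriv] psi deriv])
       (use c f_nonneg f_left f_right in \<open>simp_all only: zero step, simp_all\<close>)
qed

section \<open>Test functions of product form\<close>

lemma has_derivative_prod_coordinates:
  fixes h h' :: "'a::euclidean_space \<Rightarrow> real \<Rightarrow> real"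
  assumes "\<And>b s. b \<in> Basis \<Longrightarrow> (h b has_real_derivative h' b s) (at s)"
  shows "((\<lambda>x. \<Prod>b\<in>Basis. h b (x \<bullet> b)) has_derivative
           (\<lambda>v. \<Sum>b\<in>Basis. h' b (x \<bullet> b) * (v \<bullet> b) * (\<Prod>b'\<in>Basis - {b}. h b' (x \<bullet> b')))) (at x)"
proof -
  have "((\<lambda>x. h b (x \<bullet> b)) has_derivative (\<lambda>v. h' b (x \<bullet> b) * (v \<bullet> b))) (at x)"
    if "b \<in> Basis" for b
  proof -
    have *: "((\<lambda>x. x \<bullet> b) has_derivative (\<lambda>v. v \<bullet> b)) (at x)"
      by (auto intro!: derivative_eq_intros)
    have "(h b has_derivative (*) (h' b (x \<bullet> b))) (at (x \<bullet> b))"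
      using assms[OF that] by (simp add: has_field_derivative_def)
    from has_derivative_compose[OF * this] show ?thesis by simp
  qed
  from has_derivative_prod[where I = Basis and f = "\<lambda>b x. h b (x \<bullet> b)", OF this]
  show ?thesis by simp
qed

text \<open>
  A partial derivative keeps the product form and only exchanges one factor for its derivative.
  This closure property is what makes the iterated partial derivatives in \<open>C_k\<close> tractable.
\<close>
lemma partial_deriv_prod_coordinates:
  fixes h h' :: "'a::euclidean_space \<Rightarrow> real \<Rightarrow> real"
  assumes "\<And>b s. b \<in> Basis \<Longrightarrow> (h b has_real_derivative h' b s) (at s)" and "c \<in> Basis"
  shows "partial_deriv c (\<lambda>x. \<Prod>b\<in>Basis. h b (x \<bullet> b)) = (\<lambda>x. \<Prod>b\<in>Basis. (h(c := h' c)) b (x \<bullet> b))"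
proof
  fix x
  have "partial_deriv c (\<lambda>x. \<Prod>b\<in>Basis. h b (x \<bullet> b)) x =
      (\<Sum>b\<in>Basis. h' b (x \<bullet> b) * (c \<bullet> b) * (\<Prod>b'\<in>Basis - {b}. h b' (x \<bullet> b')))"
    unfolding partial_deriv_def
    by (subst frechet_derivative_at[OF has_derivative_prod_coordinates[OF assms(1)], symmetric]) auto
  also have "\<dots> = (\<Sum>b\<in>Basis. if b = c then h' b (x \<bullet> b) * (\<Prod>b'\<in>Basis - {b}. h b' (x \<bullet> b')) else 0)"
    using assms(2) by (intro sum.cong refl) (auto simp: inner_Basis)
  also have "\<dots> = h' c (x \<bullet> c) * (\<Prod>b'\<in>Basis - {c}. h b' (x \<bullet> b'))"
    using assms(2) by simp
  also have "\<dots> = (\<Prod>b\<in>Basis. (h(c := h' c)) b (x \<bullet> b))"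
    using assms(2) by (subst (2) prod.remove[of _ c]) (auto intro!: prod.cong)
  finally show "partial_deriv c (\<lambda>x. \<Prod>b\<in>Basis. h b (x \<bullet> b)) x = (\<Prod>b\<in>Basis. (h(c := h' c)) b (x \<bullet> b))" .
qed

text \<open>
  The order drops by one because \<open>C_k 0\<close> demands continuity, which
  \<open>times_differentiable 0\<close> does not give.
\<close>
lemma C_k_prod_coordinates:
  fixes h :: "'a::euclidean_space \<Rightarrow> real \<Rightarrow> real"
  assumes "\<And>b. b \<in> Basis \<Longrightarrow> times_differentiable (Suc k) (h b)"
  shows "C_k k (\<lambda>x. \<Prod>b\<in>Basis. h b (x \<bullet> b))"
  using assms
proof (induction k arbitrary: h)
  case 0
  then have "\<forall>b\<in>Basis. \<exists>h'. \<forall>x. (h b has_real_derivative h' x) (at x)" by simp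
  then obtain h' where "\<forall>b\<in>Basis. \<forall>x. (h b has_real_derivative h' b x) (at x)" by metis
  then show ?case
    by (auto intro!: continuous_at_imp_continuous_on has_derivative_continuous
        has_derivative_prod_coordinates)
next
  case (Suc k)
  then have "\<forall>b\<in>Basis. \<exists>h'. (\<forall>x. (h b has_real_derivative h' x) (at x)) \<and> times_differentiable (Suc k) h'"
    by (metis times_differentiable.simps(2))
  then obtain h' where h': "\<And>b x. b \<in> Basis \<Longrightarrow> (h b has_real_derivative h' b x) (at x)"
    "\<And>b. b \<in> Basis \<Longrightarrow> times_differentiable (Suc k) (h' b)" by metis
  have "(\<lambda>x. \<Prod>b\<in>Basis. h b (x \<bullet> b)) differentiable_on UNIV"
    using has_derivative_prod_coordinates[of h h'] h'(1)
    by (auto simp: differentiable_on_def differentiable_def)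
  moreover have "C_k k (partial_deriv c (\<lambda>x. \<Prod>b\<in>Basis. h b (x \<bullet> b)))" if "c \<in> Basis" for c
  proof -
    have "partial_deriv c (\<lambda>x. \<Prod>b\<in>Basis. h b (x \<bullet> b)) = (\<lambda>x. \<Prod>b\<in>Basis. (h(c := h' c)) b (x \<bullet> b))"
      by (rule partial_deriv_prod_coordinates[of h h', OF h'(1) that])
    moreover have "times_differentiable (Suc k) ((h(c := h' c)) b)" if "b \<in> Basis" for b
      using that h'(2) times_differentiable_SucD[OF Suc.prems[OF that]] by (cases "b = c") auto
    ultimately show ?thesis
      using Suc.IH[of "h(c := h' c)"] by simp
  qed
  ultimately show ?case by simp
qed

lemma test_function_prod_coordinates:
  fixes h :: "'a::euclidean_space \<Rightarrow> real \<Rightarrow> real"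
  assumes smooth: "\<And>b. b \<in> Basis \<Longrightarrow> smooth (h b)"
    and support: "\<And>b s. b \<in> Basis \<Longrightarrow> \<bar>s\<bar> > r \<Longrightarrow> h b s = 0"
  shows "test_function (\<lambda>x. \<Prod>b\<in>Basis. h b (x \<bullet> b))"
proof -
  have "{x. (\<Prod>b\<in>Basis. h b (x \<bullet> b)) \<noteq> 0} \<subseteq> cbox (\<Sum>b\<in>Basis. - r *\<^sub>R b) (\<Sum>b\<in>Basis. r *\<^sub>R b)"
  proof (intro subsetI)
    fix x assume "x \<in> {x. (\<Prod>b\<in>Basis. h b (x \<bullet> b)) \<noteq> 0}"
    then have "\<bar>x \<bullet> b\<bar> \<le> r" if "b \<in> Basis" for b
      using support[OF that, of "x \<bullet> b"] that by force
    then show "x \<in> cbox (\<Sum>b\<in>Basis. - r *\<^sub>R b) (\<Sum>b\<in>Basis. r *\<^sub>R b)"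
      by (auto simp: mem_box abs_le_iff minus_le_iff simp del: scaleR_minus_left)
  qed
  then have "bounded {x. (\<Prod>b\<in>Basis. h b (x \<bullet> b)) \<noteq> 0}"
    using bounded_cbox bounded_subset by blast
  then have "compact (closure {x. (\<Prod>b\<in>Basis. h b (x \<bullet> b)) \<noteq> 0})"
    by (simp add: compact_closure)
  with smooth show ?thesis
    by (auto simp: test_function_def smooth_def intro!: C_k_prod_coordinates simp del: times_differentiable.simps)
qed

section \<open>Lipschitz continuity from a bounded weak gradient\<close>

text \<open>
  The bump \<open>\<psi>\<close> is the derivative of the step \<open>\<Psi>\<close>, so its integral is the total rise of \<open>\<Psi>\<close>;
  a translation does not change it.
\<close>
lemma nn_integral_smooth_step_deriv:
  fixes \<delta> :: real
  assumes \<delta>: "\<delta> > 0" and \<psi>: "smooth \<psi>" and deriv: "\<And>s. (\<Psi> has_real_derivative \<psi> s) (at s)"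
    and nonneg: "\<And>s. 0 \<le> \<psi> s"
    and support: "\<And>s. s \<le> 0 \<Longrightarrow> \<psi> s = 0" "\<And>s. s \<ge> \<delta> \<Longrightarrow> \<psi> s = 0"
    and ends: "\<Psi> 0 = 0" "\<Psi> \<delta> = 1"
  shows "(\<integral>\<^sup>+s. ennreal (\<psi> (s - a)) \<partial>lborel) = 1"
proof -
  have [measurable]: "\<psi> \<in> borel_measurable borel" using \<psi> by (rule smooth_borel_measurable)
  have "(\<integral>\<^sup>+s. ennreal (\<psi> (s - a)) \<partial>lborel) = (\<integral>\<^sup>+s. ennreal (\<psi> s) \<partial>lborel)"
    by (subst nn_integral_real_affine[where c = 1 and t = a]) auto
  also have "\<dots> = (\<integral>\<^sup>+s. ennreal (\<psi> s) * indicator {0..\<delta>} s \<partial>lborel)"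
    using support by (intro nn_integral_cong) (auto simp: indicator_def not_le)
  also have "\<dots> = ennreal (\<Psi> \<delta> - \<Psi> 0)"
    using deriv nonneg \<delta> by (intro nn_integral_FTC_Icc) auto
  finally show ?thesis using ends by simp
qed

text \<open>
  Local averages with respect to a probability density recover the values of a continuous
  function up to its oscillation on the support of the density.
\<close>
lemma average_near_value:
  fixes \<phi> \<rho> :: "'a \<Rightarrow> real"
  assumes \<rho>: "integrable \<mu> \<rho>" "(\<integral>y. \<rho> y \<partial>\<mu>) = 1" "\<And>y. 0 \<le> \<rho> y"
    and \<phi>: "\<phi> \<in> borel_measurable \<mu>" and close: "\<And>y. \<rho> y \<noteq> 0 \<Longrightarrow> \<bar>\<phi> y - c\<bar> \<le> e"
  shows "integrable \<mu> (\<lambda>y. \<phi> y * \<rho> y)" "\<bar>(\<integral>y. \<phi> y * \<rho> y \<partial>\<mu>) - c\<bar> \<le> e"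
proof -
  have bound: "\<bar>(\<phi> y - c) * \<rho> y\<bar> \<le> e * \<rho> y" for y
    using close[of y] \<rho>(3)[of y] by (cases "\<rho> y = 0") (auto simp: abs_mult intro!: mult_right_mono)
  have int: "integrable \<mu> (\<lambda>y. (\<phi> y - c) * \<rho> y)"
  proof (rule Bochner_Integration.integrable_bound)
    show "integrable \<mu> (\<lambda>y. e * \<rho> y)" using \<rho>(1) by simp
    show "AE y in \<mu>. norm ((\<phi> y - c) * \<rho> y) \<le> norm (e * \<rho> y)"
      unfolding real_norm_def by (intro AE_I2 order_trans[OF bound abs_ge_self])
  qed (use \<rho>(1) \<phi> in measurable)
  have "integrable \<mu> (\<lambda>y. (\<phi> y - c) * \<rho> y + c * \<rho> y)"
    using int \<rho>(1) by auto
  then show int': "integrable \<mu> (\<lambda>y. \<phi> y * \<rho> y)"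
    by (simp add: algebra_simps)
  have "(\<integral>y. \<phi> y * \<rho> y \<partial>\<mu>) - c = (\<integral>y. \<phi> y * \<rho> y \<partial>\<mu>) - (\<integral>y. c * \<rho> y \<partial>\<mu>)"
    using \<rho>(1,2) by simp
  also have "\<dots> = (\<integral>y. (\<phi> y - c) * \<rho> y \<partial>\<mu>)"
    using int' \<rho>(1) by (subst Bochner_Integration.integral_diff[symmetric]) (auto simp: algebra_simps)
  also have "\<bar>\<dots>\<bar> \<le> (\<integral>y. e * \<rho> y \<partial>\<mu>)"
    using \<rho>(1) int bound
    by (intro order_trans[OF integral_abs_bound] integral_mono) auto
  also have "\<dots> = e" using \<rho> by simp
  finally show "\<bar>(\<integral>y. \<phi> y * \<rho> y \<partial>\<mu>) - c\<bar> \<le> e" .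
qed

lemma abs_integral_le_nn_integral:
  fixes f :: "'a \<Rightarrow> real"
  assumes "(\<integral>\<^sup>+y. ennreal \<bar>f y\<bar> \<partial>\<mu>) \<le> ennreal c" "c \<ge> 0"
  shows "\<bar>\<integral>y. f y \<partial>\<mu>\<bar> \<le> c"
proof (cases "integrable \<mu> f")
  case True
  have "ennreal \<bar>\<integral>y. f y \<partial>\<mu>\<bar> \<le> (\<integral>\<^sup>+y. ennreal \<bar>f y\<bar> \<partial>\<mu>)"
    using integral_norm_bound_ennreal[OF True] by simp
  with assms show ?thesis
    by (metis order_trans ennreal_le_iff)
qed (use assms in \<open>simp add: not_integrable_integral_eq\<close>)

text \<open>
  Testing with \<open>\<eta> = \<Prod>c. H c\<close>, where \<open>H b\<close> is a step from 0 to 1 at \<open>x \<bullet> b\<close> minus one at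
  \<open>x \<bullet> b + h\<close> and the other factors are bumps near \<open>x \<bullet> c\<close>, gives
  \<open>\<partial>\<^sub>b \<eta> = \<rho> x - \<rho> (x + h b)\<close> with mollifiers \<open>\<rho>\<close> of width \<open>\<delta>\<close>. The left-hand side of the weak
  derivative identity is then close to \<open>\<phi> x - \<phi> (x + h b)\<close>, and the right-hand side is at most the
  integral of \<open>\<bar>\<eta>\<bar>\<close>, hence at most \<open>h + \<delta>\<close>.
\<close>
lemma weak_gradient_bound_imp_increment_bound:
  fixes \<phi> :: "'a::euclidean_space \<Rightarrow> real"
  assumes cont: "continuous_on UNIV \<phi>" and wg: "weak_gradient \<phi> g"
    and g: "AE y in lborel. norm (g y) \<le> 1" and b: "b \<in> Basis" and h: "h > 0"
  shows "\<bar>\<phi> (x + h *\<^sub>R b) - \<phi> x\<bar> \<le> h"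
proof (rule field_le_epsilon)
  fix e0 :: real assume "e0 > 0"
  define e where "e = e0 / 3"
  have e: "e > 0" using \<open>e0 > 0\<close> by (simp add: e_def)
  have \<phi> [measurable]: "\<phi> \<in> borel_measurable borel"
    using cont by (rule borel_measurable_continuous_onI)
  have "\<exists>r>0. \<forall>y. dist y z < r \<longrightarrow> \<bar>\<phi> y - \<phi> z\<bar> \<le> e" for z
    using cont e unfolding continuous_on_iff by (metis UNIV_I dist_real_def less_imp_le)
  then obtain R where R: "R z > 0" "dist y z < R z \<Longrightarrow> \<bar>\<phi> y - \<phi> z\<bar> \<le> e" for y z
    by metis
  define r where "r = min (R x) (R (x + h *\<^sub>R b))"
  \<comment> \<open>A cube of side \<open>\<delta>\<close> has diameter less than \<open>r\<close> in the sum norm.\<close>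
  define \<delta> where "\<delta> = min e (r / (2 * DIM('a)))"
  have r: "r > 0" using R by (simp add: r_def)
  then have \<delta>: "\<delta> > 0" "\<delta> \<le> e" using e by (auto simp: \<delta>_def)
  obtain \<Psi> \<psi> where \<Psi>: "smooth \<Psi>" and \<psi>: "smooth \<psi>"
    and deriv: "\<And>s. (\<Psi> has_real_derivative \<psi> s) (at s)"
    and \<psi>_nonneg: "\<And>s. 0 \<le> \<psi> s"
    and \<psi>_left: "\<And>s. s \<le> 0 \<Longrightarrow> \<psi> s = 0" and \<psi>_right: "\<And>s. s \<ge> \<delta> \<Longrightarrow> \<psi> s = 0"
    and \<Psi>_left: "\<And>s. s \<le> 0 \<Longrightarrow> \<Psi> s = 0" and \<Psi>_right: "\<And>s. s \<ge> \<delta> \<Longrightarrow> \<Psi> s = 1"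
    using smooth_step_exists[OF \<delta>(1)] by metis
  have [measurable]: "\<psi> \<in> borel_measurable borel" "\<Psi> \<in> borel_measurable borel"
    using \<psi> \<Psi> by (auto intro: smooth_borel_measurable)
  have \<Psi>_mono: "\<Psi> s \<le> \<Psi> t" if "s \<le> t" for s t
    using DERIV_nonneg_imp_nondecreasing[OF that] deriv \<psi>_nonneg by blast
  have \<Psi>_range: "0 \<le> \<Psi> s" "\<Psi> s \<le> 1" for s
    using \<Psi>_mono[of "min s 0" s] \<Psi>_left[of "min s 0"] \<Psi>_mono[of s "max s \<delta>"] \<Psi>_right[of "max s \<delta>"]
    by auto
  have \<psi>_int: "(\<integral>\<^sup>+s. ennreal (\<psi> (s - a)) \<partial>lborel) = 1" for a
    using \<delta>(1) \<psi> deriv \<psi>_nonneg \<psi>_left \<psi>_right \<Psi>_left \<Psi>_right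
    by (intro nn_integral_smooth_step_deriv[where \<delta> = \<delta> and \<Psi> = \<Psi>]) auto

  define \<rho> where "\<rho> z y = (\<Prod>c\<in>Basis. \<psi> (y \<bullet> c - z \<bullet> c))" for z y :: 'a
  have \<rho>_measurable [measurable]: "\<rho> z \<in> borel_measurable borel" for z
    unfolding \<rho>_def by measurable
  have \<rho>_nonneg: "0 \<le> \<rho> z y" for z y
    unfolding \<rho>_def using \<psi>_nonneg by (intro prod_nonneg) auto
  have "(\<integral>\<^sup>+y. ennreal (\<rho> z y) \<partial>lborel) = 1" for z
  proof -
    have "(\<integral>\<^sup>+y. ennreal (\<rho> z y) \<partial>lborel) = (\<integral>\<^sup>+y. (\<Prod>c\<in>Basis. ennreal (\<psi> (y \<bullet> c - z \<bullet> c))) \<partial>lborel)"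
      unfolding \<rho>_def using \<psi>_nonneg by (simp add: prod_ennreal)
    also have "\<dots> = (\<Prod>c\<in>Basis. \<integral>\<^sup>+s. ennreal (\<psi> (s - z \<bullet> c)) \<partial>lborel)"
      by (rule nn_integral_lborel_prod[of "\<lambda>c s. ennreal (\<psi> (s - z \<bullet> c))"]) auto
    finally show ?thesis using \<psi>_int by simp
  qed
  then have \<rho>_int: "integrable lborel (\<rho> z)" "(\<integral>y. \<rho> z y \<partial>lborel) = 1" for z
    using \<rho>_nonneg
    by (auto simp: integrable_iff_bounded integral_eq_nn_integral)
  have close: "\<bar>\<phi> y - \<phi> z\<bar> \<le> e" if "\<rho> z y \<noteq> 0" and "r \<le> R z" for y z
  proof -
    have "0 \<le> (y - z) \<bullet> c \<and> (y - z) \<bullet> c \<le> \<delta>" if "c \<in> Basis" for c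
    proof -
      have "\<psi> (y \<bullet> c - z \<bullet> c) \<noteq> 0"
        using \<open>\<rho> z y \<noteq> 0\<close> that by (simp add: \<rho>_def)
      then show ?thesis
        using \<psi>_left[of "y \<bullet> c - z \<bullet> c"] \<psi>_right[of "y \<bullet> c - z \<bullet> c"]
        by (auto simp: inner_diff_left not_le intro: ccontr less_imp_le)
    qed
    then have "(\<Sum>c\<in>Basis. \<bar>(y - z) \<bullet> c\<bar>) \<le> real (card (Basis::'a set)) * \<delta>"
      by (intro sum_bounded_above) auto
    also have "\<dots> < r"
      using r by (simp add: \<delta>_def min_def field_simps)
    finally have "dist y z < R z"
      using norm_le_l1[of "y - z"] that(2) by (simp add: dist_norm)
    then show ?thesis by (rule R)
  qed
  have avg: "integrable lborel (\<lambda>y. \<phi> y * \<rho> z y)" "\<bar>(\<integral>y. \<phi> y * \<rho> z y \<partial>lborel) - \<phi> z\<bar> \<le> e"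
    if "r \<le> R z" for z
    using average_near_value[OF \<rho>_int \<rho>_nonneg, of \<phi> z "\<phi> z" e] close that by auto

  obtain \<psi>' where \<psi>': "\<And>s. (\<psi> has_real_derivative \<psi>' s) (at s)"
    using \<psi> unfolding smooth_def by (metis times_differentiable.simps(2))
  define H where "H c = (if c = b then (\<lambda>s. \<Psi> (s - x \<bullet> c) - \<Psi> (s - x \<bullet> c - h)) else (\<lambda>s. \<psi> (s - x \<bullet> c)))" for c
  define H' where "H' c = (if c = b then (\<lambda>s. \<psi> (s - x \<bullet> c) - \<psi> (s - x \<bullet> c - h)) else (\<lambda>s. \<psi>' (s - x \<bullet> c)))" for c
  define \<eta> where "\<eta> y = (\<Prod>c\<in>Basis. H c (y \<bullet> c))" for y
  have smooth_shift: "smooth (\<lambda>s. f (s - a))" if "smooth f" for f a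
    using smooth_affine[OF that, of 1 "- a"] by simp
  have H_smooth: "smooth (H c)" for c
  proof (cases "c = b")
    case True
    have "smooth (\<lambda>s. \<Psi> (s - x \<bullet> c) + (-1) * \<Psi> (s - (x \<bullet> c + h)))"
      by (intro smooth_add smooth_mult smooth_const smooth_shift \<Psi>)
    then show ?thesis using True by (simp add: H_def diff_diff_add)
  qed (simp add: H_def smooth_shift \<psi>)
  have H_deriv: "(H c has_real_derivative H' c s) (at s)" for c s
  proof (cases "c = b")
    case True
    have "((\<lambda>s. \<Psi> (s - x \<bullet> c) - \<Psi> (s - x \<bullet> c - h)) has_real_derivative
        \<psi> (s - x \<bullet> c) * (1 - 0) - \<psi> (s - x \<bullet> c - h) * (1 - 0 - 0)) (at s)"
      by (intro DERIV_diff DERIV_chain2[OF deriv] DERIV_ident DERIV_const)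
    then show ?thesis using True by (simp add: H_def H'_def)
  next
    case False
    have "((\<lambda>s. \<psi> (s - x \<bullet> c)) has_real_derivative \<psi>' (s - x \<bullet> c) * (1 - 0)) (at s)"
      by (intro DERIV_diff DERIV_chain2[OF \<psi>'] DERIV_ident DERIV_const)
    then show ?thesis using False by (simp add: H_def H'_def)
  qed
  \<comment> \<open>The length of the support replaces the exact integral of the plateau; the surplus \<open>\<delta>\<close> vanishes in the limit.\<close>
  have H_bound: "\<bar>H b s\<bar> \<le> indicator {x \<bullet> b .. x \<bullet> b + h + \<delta>} s" for s
    using \<Psi>_range[of "s - x \<bullet> b"] \<Psi>_range[of "s - x \<bullet> b - h"]
      \<Psi>_left[of "s - x \<bullet> b"] \<Psi>_left[of "s - x \<bullet> b - h"]
      \<Psi>_right[of "s - x \<bullet> b"] \<Psi>_right[of "s - x \<bullet> b - h"] h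
    by (auto simp: H_def indicator_def)
  have "test_function \<eta>"
    unfolding \<eta>_def
  proof (rule test_function_prod_coordinates[OF H_smooth])
    fix c :: 'a and s assume c: "c \<in> Basis" and s: "norm x + h + \<delta> < \<bar>s\<bar>"
    have "s - x \<bullet> c \<le> 0 \<and> s - x \<bullet> c - h \<le> 0 \<or> s - x \<bullet> c \<ge> \<delta> \<and> s - x \<bullet> c - h \<ge> \<delta>"
      using s Basis_le_norm[OF c, of x] h \<delta> by linarith
    then show "H c s = 0"
      using \<Psi>_left \<Psi>_right \<psi>_left \<psi>_right by (auto simp: H_def)
  qed
  then have "(\<integral>y. \<phi> y * partial_deriv b \<eta> y \<partial>lborel) = - (\<integral>y. (g y \<bullet> b) * \<eta> y \<partial>lborel)"
    using wg b unfolding weak_gradient_def by blast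
  moreover have "partial_deriv b \<eta> y = \<rho> x y - \<rho> (x + h *\<^sub>R b) y" for y
  proof -
    have shift: "(\<Prod>c\<in>Basis - {b}. \<psi> (y \<bullet> c - (x + h *\<^sub>R b) \<bullet> c)) = (\<Prod>c\<in>Basis - {b}. \<psi> (y \<bullet> c - x \<bullet> c))"
      using b by (intro prod.cong) (auto simp: inner_add_left inner_Basis)
    have "partial_deriv b \<eta> y = (\<Prod>c\<in>Basis. (H(b := H' b)) c (y \<bullet> c))"
      unfolding \<eta>_def by (subst partial_deriv_prod_coordinates[OF H_deriv b]) auto
    also have "\<dots> = (\<psi> (y \<bullet> b - x \<bullet> b) - \<psi> (y \<bullet> b - x \<bullet> b - h)) * (\<Prod>c\<in>Basis - {b}. \<psi> (y \<bullet> c - x \<bullet> c))"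
      using b by (subst prod.remove[of _ b]) (auto simp: H_def H'_def intro!: prod.cong)
    also have "\<dots> = \<psi> (y \<bullet> b - x \<bullet> b) * (\<Prod>c\<in>Basis - {b}. \<psi> (y \<bullet> c - x \<bullet> c)) -
        \<psi> (y \<bullet> b - (x + h *\<^sub>R b) \<bullet> b) * (\<Prod>c\<in>Basis - {b}. \<psi> (y \<bullet> c - x \<bullet> c))"
      using b by (simp add: left_diff_distrib inner_add_left diff_diff_add)
    finally show ?thesis
      unfolding \<rho>_def using b shift by (simp add: prod.remove[of _ b])
  qed
  ultimately have "(\<integral>y. \<phi> y * (\<rho> x y - \<rho> (x + h *\<^sub>R b) y) \<partial>lborel) = - (\<integral>y. (g y \<bullet> b) * \<eta> y \<partial>lborel)"
    by simp
  then have parts: "(\<integral>y. \<phi> y * \<rho> x y \<partial>lborel) - (\<integral>y. \<phi> y * \<rho> (x + h *\<^sub>R b) y \<partial>lborel) =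
      - (\<integral>y. (g y \<bullet> b) * \<eta> y \<partial>lborel)"
    using avg(1)[of x] avg(1)[of "x + h *\<^sub>R b"] by (simp add: right_diff_distrib r_def)
  have "(\<integral>\<^sup>+y. ennreal \<bar>(g y \<bullet> b) * \<eta> y\<bar> \<partial>lborel) \<le> (\<integral>\<^sup>+y. ennreal \<bar>\<eta> y\<bar> \<partial>lborel)"
  proof (intro nn_integral_mono_AE eventually_mono[OF g] ennreal_leI)
    fix y assume "norm (g y) \<le> 1"
    then have "\<bar>g y \<bullet> b\<bar> \<le> 1" using Basis_le_norm[OF b, of "g y"] by simp
    then show "\<bar>(g y \<bullet> b) * \<eta> y\<bar> \<le> \<bar>\<eta> y\<bar>"
      by (simp add: abs_mult mult_left_le_one_le)
  qed
  also have "\<dots> = (\<integral>\<^sup>+y. (\<Prod>c\<in>Basis. ennreal \<bar>H c (y \<bullet> c)\<bar>) \<partial>lborel)"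
    by (simp add: \<eta>_def prod_ennreal abs_prod)
  also have "\<dots> = (\<Prod>c\<in>Basis. \<integral>\<^sup>+s. ennreal \<bar>H c s\<bar> \<partial>lborel)"
    using H_smooth by (intro nn_integral_lborel_prod[of "\<lambda>c s. ennreal \<bar>H c s\<bar>"]) (auto intro: smooth_borel_measurable)
  also have "\<dots> = (\<integral>\<^sup>+s. ennreal \<bar>H b s\<bar> \<partial>lborel) * (\<Prod>c\<in>Basis - {b}. \<integral>\<^sup>+s. ennreal \<bar>H c s\<bar> \<partial>lborel)"
    using b by (simp add: prod.remove)
  also have "(\<Prod>c\<in>Basis - {b}. \<integral>\<^sup>+s. ennreal \<bar>H c s\<bar> \<partial>lborel) = 1"
    using \<psi>_int \<psi>_nonneg by (intro prod.neutral) (auto simp: H_def)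
  also have "(\<integral>\<^sup>+s. ennreal \<bar>H b s\<bar> \<partial>lborel) \<le> (\<integral>\<^sup>+s. indicator {x \<bullet> b .. x \<bullet> b + h + \<delta>} s \<partial>lborel)"
    using H_bound by (intro nn_integral_mono) (metis ennreal_indicator ennreal_leI)
  also have "\<dots> = ennreal (h + \<delta>)"
    using h \<delta> by simp
  finally have "\<bar>\<integral>y. (g y \<bullet> b) * \<eta> y \<partial>lborel\<bar> \<le> h + \<delta>"
    using h \<delta> by (intro abs_integral_le_nn_integral) auto
  moreover have "\<bar>(\<integral>y. \<phi> y * \<rho> x y \<partial>lborel) - \<phi> x\<bar> \<le> e"
    "\<bar>(\<integral>y. \<phi> y * \<rho> (x + h *\<^sub>R b) y \<partial>lborel) - \<phi> (x + h *\<^sub>R b)\<bar> \<le> e"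
    by (intro avg(2); simp add: r_def)+
  moreover have "e0 = 3 * e" by (simp add: e_def)
  ultimately show "\<bar>\<phi> (x + h *\<^sub>R b) - \<phi> x\<bar> \<le> h + e0"
    using parts \<delta>(2) by linarith
qed

text \<open>
  Walking from \<open>x\<close> to \<open>y\<close> along the coordinate directions. The resulting constant is the one for the
  sum norm instead of the Euclidean norm, which costs a factor depending on the dimension.
\<close>
lemma weak_gradient_bound_imp_Lipschitz:
  fixes \<phi> :: "'a::euclidean_space \<Rightarrow> real"
  assumes cont: "continuous_on UNIV \<phi>" and wg: "weak_gradient \<phi> g"
    and g: "AE y in lborel. norm (g y) \<le> 1"
  shows "\<bar>\<phi> y - \<phi> x\<bar> \<le> (\<Sum>b\<in>Basis. \<bar>(y - x) \<bullet> b\<bar>)"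
proof -
  \<comment> \<open>A negative increment is a positive one seen from its end point.\<close>
  have step: "\<bar>\<phi> (x + h *\<^sub>R b) - \<phi> x\<bar> \<le> \<bar>h\<bar>" if b: "b \<in> Basis" for x h b
  proof -
    consider "h > 0" | "h < 0" | "h = 0" by linarith
    then show ?thesis
    proof cases
      case 1
      then show ?thesis
        using weak_gradient_bound_imp_increment_bound[OF cont wg g b, of h x] by simp
    next
      case 2
      then show ?thesis
        using weak_gradient_bound_imp_increment_bound[OF cont wg g b, of "- h" "x + h *\<^sub>R b"]
        by (simp add: abs_minus_commute)
    qed simp
  qed
  have "\<bar>\<phi> (x + (\<Sum>b\<in>B. ((y - x) \<bullet> b) *\<^sub>R b)) - \<phi> x\<bar> \<le> (\<Sum>b\<in>B. \<bar>(y - x) \<bullet> b\<bar>)" if "B \<subseteq> Basis" for B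
    using finite_subset[OF that finite_Basis] that
  proof (induction B rule: finite_induct)
    case (insert b B)
    then show ?case
      using step[of b "x + (\<Sum>b\<in>B. ((y - x) \<bullet> b) *\<^sub>R b)" "(y - x) \<bullet> b"]
      by (simp add: add_ac)
  qed simp
  from this[of Basis] show ?thesis
    by (simp add: euclidean_representation)
qed

lemma Linf_norm_le_1_AE:
  assumes "Linf_norm f \<le> 1"
  shows "AE x in lborel. norm (f x) \<le> 1"
proof -
  have "AE x in lborel. ennreal (norm (f x)) \<le> esssup lborel (\<lambda>x. ennreal (norm (f x)))"
    by (rule esssup_AE)
  then show ?thesis
  proof (rule eventually_mono)
    fix x assume "ennreal (norm (f x)) \<le> esssup lborel (\<lambda>x. ennreal (norm (f x)))"
    also have "\<dots> \<le> ennreal 1" using assms by (simp add: Linf_norm_def)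
    finally show "norm (f x) \<le> 1" by (subst (asm) ennreal_le_iff) auto
  qed
qed

text \<open>
  A closed set of full measure is everything, so for a continuous function the bound almost
  everywhere holds at every point. This matters because the empirical measure is atomic.
\<close>
lemma Linf_norm_le_1_continuous:
  fixes \<phi> :: "'a::euclidean_space \<Rightarrow> real"
  assumes cont: "continuous_on UNIV \<phi>" and le: "Linf_norm \<phi> \<le> 1"
  shows "\<bar>\<phi> x\<bar> \<le> 1"
proof -
  have "closed (\<phi> -` {-1..1})"
    using cont by (intro closed_vimage) auto
  moreover have "AE x in lebesgue. x \<in> \<phi> -` {-1..1}"
    using Linf_norm_le_1_AE[OF le] by (intro AE_completion) (auto simp: abs_le_iff elim!: eventually_mono)
  ultimately have "x \<in> \<phi> -` {-1..1}" by (rule mem_closed_if_AE_lebesgue)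
  then show ?thesis by auto
qed

section \<open>Integration against the empirical measure and its mean\<close>

text \<open>
  The definition gives additivity for measures of sets; approximation by simple functions extends it
  to integrals.
\<close>
lemma nn_integral_sum_measure:
  fixes \<mu> :: "'i \<Rightarrow> 'a::topological_space measure"
  assumes sets: "\<And>i. i \<in> I \<Longrightarrow> sets (\<mu> i) = sets borel" and f: "f \<in> borel_measurable borel"
  shows "(\<integral>\<^sup>+x. f x \<partial>sum_measure I \<mu>) = (\<Sum>i\<in>I. \<integral>\<^sup>+x. f x \<partial>\<mu> i)"
  using f
proof (induction rule: borel_measurable_induct)
  case (cong f g)
  then have "f = g" by auto
  with cong show ?case by simp
next
  case (set A)
  then show ?case using sets by (simp add: emeasure_sum_measure)
next
  case (mult u c)
  have "(\<integral>\<^sup>+x. c * u x \<partial>\<mu> i) = c * (\<integral>\<^sup>+x. u x \<partial>\<mu> i)" if "i \<in> I" for i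
    using mult(1,2) sets[OF that] by (intro nn_integral_cmult) (simp cong: measurable_cong_sets)
  then show ?case
    using mult by (simp add: nn_integral_cmult sum_distrib_left cong: measurable_cong_sets)
next
  case (add u v)
  have "(\<integral>\<^sup>+x. v x + u x \<partial>\<mu> i) = (\<integral>\<^sup>+x. v x \<partial>\<mu> i) + (\<integral>\<^sup>+x. u x \<partial>\<mu> i)" if "i \<in> I" for i
    using add sets[OF that] by (intro nn_integral_add) (simp_all cong: measurable_cong_sets)
  then show ?case
    using add by (simp add: nn_integral_add sum.distrib cong: measurable_cong_sets)
next
  case (seq U)
  have SUP: "(\<integral>\<^sup>+x. (SUP n. U n x) \<partial>\<mu> i) = (SUP n. \<integral>\<^sup>+x. U n x \<partial>\<mu> i)" if "i \<in> I" for i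
    using seq sets[OF that] by (intro nn_integral_monotone_convergence_SUP) (simp_all cong: measurable_cong_sets)
  have "(\<integral>\<^sup>+x. (SUP n. U n x) \<partial>sum_measure I \<mu>) = (SUP n. \<integral>\<^sup>+x. U n x \<partial>sum_measure I \<mu>)"
    using seq by (intro nn_integral_monotone_convergence_SUP) (simp_all cong: measurable_cong_sets)
  also have "\<dots> = (SUP n. \<Sum>i\<in>I. \<integral>\<^sup>+x. U n x \<partial>\<mu> i)"
    using seq by simp
  also have "\<dots> = (\<Sum>i\<in>I. SUP n. \<integral>\<^sup>+x. U n x \<partial>\<mu> i)"
    using seq by (intro ennreal_SUP_sum) (auto intro!: incseq_nn_integral)
  also have "\<dots> = (\<Sum>i\<in>I. \<integral>\<^sup>+x. (SUP n. U n x) \<partial>\<mu> i)"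
    using SUP by simp
  finally show ?case by (simp add: image_comp)
qed

lemma integral_sum_measure:
  fixes \<mu> :: "'i \<Rightarrow> 'a::topological_space measure" and f :: "'a \<Rightarrow> real"
  assumes fin: "finite I" and sets: "\<And>i. i \<in> I \<Longrightarrow> sets (\<mu> i) = sets borel"
    and int: "\<And>i. i \<in> I \<Longrightarrow> integrable (\<mu> i) f" and f: "f \<in> borel_measurable borel"
  shows "(\<integral>x. f x \<partial>sum_measure I \<mu>) = (\<Sum>i\<in>I. \<integral>x. f x \<partial>\<mu> i)"
proof -
  have finite: "(\<integral>\<^sup>+x. ennreal (f x) \<partial>\<mu> i) \<noteq> \<infinity>" "(\<integral>\<^sup>+x. ennreal (- f x) \<partial>\<mu> i) \<noteq> \<infinity>" if "i \<in> I" for i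
    using int[OF that] by (auto simp: real_integrable_def)
  have "(\<integral>\<^sup>+x. ennreal (norm (f x)) \<partial>\<mu> i) < \<infinity>" if "i \<in> I" for i
    using int[OF that] by (simp add: integrable_iff_bounded)
  then have "integrable (sum_measure I \<mu>) f"
    using fin f sets by (simp add: integrable_iff_bounded nn_integral_sum_measure cong: measurable_cong_sets)
  then have "(\<integral>x. f x \<partial>sum_measure I \<mu>) =
      enn2real (\<Sum>i\<in>I. \<integral>\<^sup>+x. ennreal (f x) \<partial>\<mu> i) - enn2real (\<Sum>i\<in>I. \<integral>\<^sup>+x. ennreal (- f x) \<partial>\<mu> i)"
    using f sets by (simp add: real_lebesgue_integral_def nn_integral_sum_measure)
  also have "\<dots> = (\<Sum>i\<in>I. enn2real (\<integral>\<^sup>+x. ennreal (f x) \<partial>\<mu> i) - enn2real (\<integral>\<^sup>+x. ennreal (- f x) \<partial>\<mu> i))"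
    using finite by (simp add: enn2real_sum sum_subtractf less_top)
  also have "\<dots> = (\<Sum>i\<in>I. \<integral>x. f x \<partial>\<mu> i)"
    using int by (intro sum.cong refl) (simp add: real_lebesgue_integral_def)
  finally show ?thesis .
qed

lemma scale_measure_eq_density: "scale_measure r \<mu> = density \<mu> (\<lambda>_. r)"
  by (rule measure_eqI) (auto simp: emeasure_density_const)

lemma integral_scale_measure:
  fixes f :: "'a \<Rightarrow> real"
  assumes "c \<ge> 0" "f \<in> borel_measurable \<mu>"
  shows "(\<integral>x. f x \<partial>scale_measure (ennreal c) \<mu>) = c * (\<integral>x. f x \<partial>\<mu>)"
  using assms by (simp add: scale_measure_eq_density integral_density)

lemma integrable_scale_measure:
  fixes f :: "'a \<Rightarrow> real"
  assumes "c \<ge> 0" "integrable \<mu> f"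
  shows "integrable (scale_measure (ennreal c) \<mu>) f"
  using assms by (auto simp: scale_measure_eq_density integrable_density)

lemma sets_weighted_law [simp, measurable_cong]: "sets (weighted_law P X m) = sets borel"
  by (simp add: weighted_law_def)

lemma integral_empirical_measure:
  fixes X :: "nat \<Rightarrow> 'w \<Rightarrow> 'a::topological_space"
  assumes f: "f \<in> borel_measurable borel" and m: "\<And>i. i \<in> {1..N} \<Longrightarrow> 0 \<le> m i \<omega>"
  shows "(\<integral>x. f x \<partial>empirical_measure N X m \<omega>) = (\<Sum>i\<in>{1..N}. m i \<omega> * f (X i \<omega>)) / real N"
proof -
  have "integrable (return borel (X i \<omega>)) f" for i
    using f by (simp add: integrable_iff_bounded nn_integral_return)
  then have "(\<integral>x. f x \<partial>sum_measure {1..N} (\<lambda>i. scale_measure (ennreal (m i \<omega>)) (return borel (X i \<omega>)))) =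
      (\<Sum>i\<in>{1..N}. \<integral>x. f x \<partial>scale_measure (ennreal (m i \<omega>)) (return borel (X i \<omega>)))"
    using f m by (intro integral_sum_measure integrable_scale_measure) auto
  also have "\<dots> = (\<Sum>i\<in>{1..N}. m i \<omega> * f (X i \<omega>))"
    using f m by (intro sum.cong refl) (simp add: integral_scale_measure integral_return)
  finally show ?thesis
    unfolding empirical_measure_def
    using f by (subst integral_scale_measure) (simp_all cong: measurable_cong_sets)
qed

lemma integral_mean_measure:
  fixes X :: "nat \<Rightarrow> 'w \<Rightarrow> 'a::topological_space"
  assumes f: "f \<in> borel_measurable borel"
    and X: "\<And>i. i \<in> {1..N} \<Longrightarrow> X i \<in> borel_measurable P"
    and m: "\<And>i. i \<in> {1..N} \<Longrightarrow> m i \<in> borel_measurable P"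
    and m_nonneg: "\<And>i \<omega>. i \<in> {1..N} \<Longrightarrow> 0 \<le> m i \<omega>"
    and int: "\<And>i. i \<in> {1..N} \<Longrightarrow> integrable P (\<lambda>\<omega>. m i \<omega> * f (X i \<omega>))"
  shows "(\<integral>x. f x \<partial>mean_measure P N X m) = (\<Sum>i\<in>{1..N}. \<integral>\<omega>. m i \<omega> * f (X i \<omega>) \<partial>P) / real N"
proof -
  have "integrable (weighted_law P (X i) (m i)) f" if i: "i \<in> {1..N}" for i
    unfolding weighted_law_def using f X[OF i] m[OF i] m_nonneg[OF i] int[OF i]
    by (subst integrable_distr_eq) (auto simp: integrable_density)
  moreover have "(\<integral>x. f x \<partial>weighted_law P (X i) (m i)) = (\<integral>\<omega>. m i \<omega> * f (X i \<omega>) \<partial>P)"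
    if i: "i \<in> {1..N}" for i
    unfolding weighted_law_def using f X[OF i] m[OF i] m_nonneg[OF i]
    by (subst integral_distr) (auto simp: integral_density)
  ultimately have "(\<integral>x. f x \<partial>sum_measure {1..N} (\<lambda>i. weighted_law P (X i) (m i))) =
      (\<Sum>i\<in>{1..N}. \<integral>\<omega>. m i \<omega> * f (X i \<omega>) \<partial>P)"
    using f by (subst integral_sum_measure) auto
  then show ?thesis
    unfolding mean_measure_def
    using f by (subst integral_scale_measure) (simp_all cong: measurable_cong_sets)
qed

text \<open>
  The supremum in the flat metric is over an uncountable family. As a function of the positions and
  weights \<open>z\<close> each member is continuous, so the supremum is lower semicontinuous in \<open>z\<close> and hence
  Borel; it is then composed with the measurable map \<open>Z\<close> from the sample to \<open>z\<close>. The entries of \<open>z\<close>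
  are indexed by all natural numbers, padded by zeros, so that \<open>z\<close> lives in a second countable space
  whose Borel and product sigma-algebras agree.
\<close>
lemma borel_measurable_flat_dist:
  fixes X :: "nat \<Rightarrow> 'w \<Rightarrow> 'a::euclidean_space"
  assumes X: "\<And>i. i \<in> {1..N} \<Longrightarrow> X i \<in> borel_measurable P"
    and m: "\<And>i. i \<in> {1..N} \<Longrightarrow> m i \<in> borel_measurable P"
    and m_nonneg: "\<And>i \<omega>. i \<in> {1..N} \<Longrightarrow> 0 \<le> m i \<omega>"
  shows "(\<lambda>\<omega>. flat_dist (empirical_measure N X m \<omega>) \<nu>) \<in> borel_measurable P"
proof -
  define F :: "('a \<Rightarrow> real) set" where
    "F = {\<phi> \<in> W1inf. continuous_on UNIV \<phi> \<and> Linf_norm \<phi> \<le> 1 \<and>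
           (\<exists>g. weak_gradient \<phi> g \<and> Linf_norm g \<le> 1)}"
  define G :: "('a \<Rightarrow> real) \<Rightarrow> (nat \<Rightarrow> 'a \<times> real) \<Rightarrow> ennreal" where
    "G \<phi> z = ennreal \<bar>(\<Sum>i\<in>{1..N}. snd (z i) * \<phi> (fst (z i))) / real N - (\<integral>x. \<phi> x \<partial>\<nu>)\<bar>" for \<phi> z
  define Z :: "'w \<Rightarrow> nat \<Rightarrow> 'a \<times> real" where
    "Z \<omega> i = (if i \<in> {1..N} then (X i \<omega>, m i \<omega>) else (0, 0))" for \<omega> i
  have cont: "continuous_on UNIV (G \<phi>)" if "\<phi> \<in> F" for \<phi>
  proof -
    have "continuous_on UNIV \<phi>" using that by (simp add: F_def)
    then have "continuous_on UNIV (\<lambda>z :: nat \<Rightarrow> 'a \<times> real. \<phi> (fst (z i)))" for i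
      by (rule continuous_on_compose2)
         (auto intro!: continuous_on_fst continuous_on_product_coordinates)
    then show ?thesis
      unfolding G_def divide_inverse
      by (intro continuous_on_ennreal continuous_intros continuous_on_product_coordinates)
  qed
  have "(\<lambda>z. SUP \<phi>\<in>F. G \<phi> z) \<in> borel_measurable borel"
  proof (rule borel_measurableI_greater)
    fix y
    have "{z \<in> space borel. y < (SUP \<phi>\<in>F. G \<phi> z)} = (\<Union>\<phi>\<in>F. G \<phi> -` {y<..})"
      by (auto simp: less_SUP_iff)
    moreover have "open (G \<phi> -` {y<..})" if "\<phi> \<in> F" for \<phi>
      using cont[OF that] by (intro open_vimage) auto
    ultimately show "{z \<in> space borel. y < (SUP \<phi>\<in>F. G \<phi> z)} \<in> sets borel"
      by (auto intro!: borel_open)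
  qed
  moreover have "Z \<in> borel_measurable P"
  proof (rule measurable_coordinatewise_then_product)
    fix i show "(\<lambda>\<omega>. Z \<omega> i) \<in> borel_measurable P"
      unfolding Z_def using X m by (cases "i \<in> {1..N}") auto
  qed
  ultimately have "(\<lambda>\<omega>. SUP \<phi>\<in>F. G \<phi> (Z \<omega>)) \<in> borel_measurable P"
    by (rule measurable_compose[rotated])
  moreover have "(SUP \<phi>\<in>F. G \<phi> (Z \<omega>)) = flat_dist (empirical_measure N X m \<omega>) \<nu>" for \<omega>
  proof -
    have "G \<phi> (Z \<omega>) = ennreal \<bar>(\<integral>x. \<phi> x \<partial>empirical_measure N X m \<omega>) - (\<integral>x. \<phi> x \<partial>\<nu>)\<bar>" if "\<phi> \<in> F" for \<phi>
    proof -
      have "\<phi> \<in> borel_measurable borel"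
        using that by (auto simp: F_def intro: borel_measurable_continuous_onI)
      then show ?thesis
        using m_nonneg by (subst integral_empirical_measure) (auto simp: G_def Z_def)
    qed
    then show ?thesis
      unfolding flat_dist_def F_def[symmetric] by (intro SUP_cong) auto
  qed
  ultimately show ?thesis by simp
qed

section \<open>Sums of pairwise independent variables\<close>

text \<open>
  Pairwise independence makes the mixed terms of the expanded square vanish, and a variance is at
  most a second moment.
\<close>
lemma (in prob_space) second_moment_sum_centered_le:
  fixes Y :: "'i \<Rightarrow> 'a \<Rightarrow> real"
  assumes fin: "finite I" and Y: "\<And>i. i \<in> I \<Longrightarrow> random_variable borel (Y i)"
    and bound: "\<And>i \<omega>. i \<in> I \<Longrightarrow> \<bar>Y i \<omega>\<bar> \<le> B"
    and indep: "\<And>i j. i \<in> I \<Longrightarrow> j \<in> I \<Longrightarrow> i \<noteq> j \<Longrightarrow> indep_var borel (Y i) borel (Y j)"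
  shows "integrable M (\<lambda>\<omega>. (\<Sum>i\<in>I. Y i \<omega> - expectation (Y i))\<^sup>2)"
    and "expectation (\<lambda>\<omega>. (\<Sum>i\<in>I. Y i \<omega> - expectation (Y i))\<^sup>2) \<le> (\<Sum>i\<in>I. expectation (\<lambda>\<omega>. (Y i \<omega>)\<^sup>2))"
proof -
  define V where "V i \<omega> = Y i \<omega> - expectation (Y i)" for i \<omega>
  have Y_int: "integrable M (Y i)" if "i \<in> I" for i
    using Y[OF that] bound[OF that] by (intro integrable_const_bound[where B = B]) auto
  have Y2_int: "integrable M (\<lambda>\<omega>. Y i \<omega> * Y j \<omega>)" if "i \<in> I" "j \<in> I" for i j
    using Y[OF that(1)] Y[OF that(2)] bound[OF that(1)] bound[OF that(2)]
    by (intro integrable_const_bound[where B = "B * B"])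
       (auto simp: abs_mult intro!: AE_I2 mult_mono' intro: order_trans[OF abs_ge_zero])
  have VV: "(\<lambda>\<omega>. V i \<omega> * V j \<omega>) = (\<lambda>\<omega>. Y i \<omega> * Y j \<omega> - expectation (Y j) * Y i \<omega>
      - expectation (Y i) * Y j \<omega> + expectation (Y i) * expectation (Y j))" for i j
    by (auto simp: V_def algebra_simps)
  have VV_int: "integrable M (\<lambda>\<omega>. V i \<omega> * V j \<omega>)" if "i \<in> I" "j \<in> I" for i j
    unfolding VV using Y_int Y2_int that
    by (intro Bochner_Integration.integrable_add Bochner_Integration.integrable_diff integrable_mult_right) auto
  have cov: "expectation (\<lambda>\<omega>. V i \<omega> * V j \<omega>) = expectation (\<lambda>\<omega>. Y i \<omega> * Y j \<omega>) - expectation (Y i) * expectation (Y j)"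
    if "i \<in> I" "j \<in> I" for i j
    unfolding VV using Y_int[OF that(1)] Y_int[OF that(2)] Y2_int[OF that]
    by (simp add: prob_space)
  have square: "(\<Sum>i\<in>I. Y i \<omega> - expectation (Y i))\<^sup>2 = (\<Sum>i\<in>I. \<Sum>j\<in>I. V i \<omega> * V j \<omega>)" for \<omega>
    by (simp add: V_def power2_eq_square sum_product)
  show "integrable M (\<lambda>\<omega>. (\<Sum>i\<in>I. Y i \<omega> - expectation (Y i))\<^sup>2)"
    unfolding square using VV_int by auto
  have "expectation (\<lambda>\<omega>. (\<Sum>i\<in>I. Y i \<omega> - expectation (Y i))\<^sup>2) =
      (\<Sum>i\<in>I. \<Sum>j\<in>I. expectation (\<lambda>\<omega>. V i \<omega> * V j \<omega>))"
    unfolding square using VV_int by (simp add: Bochner_Integration.integral_sum)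
  also have "\<dots> = (\<Sum>i\<in>I. \<Sum>j\<in>I. if j = i then expectation (\<lambda>\<omega>. V i \<omega> * V i \<omega>) else 0)"
  proof (intro sum.cong refl)
    fix i j assume ij: "i \<in> I" "j \<in> I"
    show "expectation (\<lambda>\<omega>. V i \<omega> * V j \<omega>) = (if j = i then expectation (\<lambda>\<omega>. V i \<omega> * V i \<omega>) else 0)"
      using ij cov[OF ij] indep[OF ij] Y_int by (auto simp: indep_var_lebesgue_integral)
  qed
  also have "\<dots> = (\<Sum>i\<in>I. expectation (\<lambda>\<omega>. V i \<omega> * V i \<omega>))"
    using fin by simp
  also have "\<dots> \<le> (\<Sum>i\<in>I. expectation (\<lambda>\<omega>. (Y i \<omega>)\<^sup>2))"
    by (intro sum_mono) (simp add: cov power2_eq_square)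
  finally show "expectation (\<lambda>\<omega>. (\<Sum>i\<in>I. Y i \<omega> - expectation (Y i))\<^sup>2) \<le> (\<Sum>i\<in>I. expectation (\<lambda>\<omega>. (Y i \<omega>)\<^sup>2))" .
qed

section \<open>Approximation by step functions on a grid of cubes\<close>

text \<open>
  The cube \<open>\<Prod>b. [\<epsilon> k\<^sub>b, \<epsilon> (k\<^sub>b + 1))\<close> of the grid is addressed by the family \<open>k\<close> of integers, restricted
  to \<open>Basis\<close> so that each cube has only one address.
\<close>
definition cell_index :: "real \<Rightarrow> 'a::euclidean_space \<Rightarrow> 'a \<Rightarrow> int" where
  "cell_index \<epsilon> y = (\<lambda>b\<in>Basis. \<lfloor>(y \<bullet> b) / \<epsilon>\<rfloor>)"

definition cell_corner :: "real \<Rightarrow> ('a \<Rightarrow> int) \<Rightarrow> 'a::euclidean_space" where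
  "cell_corner \<epsilon> k = (\<Sum>b\<in>Basis. (\<epsilon> * of_int (k b)) *\<^sub>R b)"

text \<open>
  A cube that meets the ball of radius \<open>t * \<epsilon>\<close> around the origin has its address here.
\<close>
definition box_cells :: "real \<Rightarrow> ('a::euclidean_space \<Rightarrow> int) set" where
  "box_cells t = Basis \<rightarrow>\<^sub>E {\<lfloor>- t\<rfloor>..\<lfloor>t\<rfloor>}"

lemma finite_box_cells [simp]: "finite (box_cells t)"
  by (simp add: box_cells_def finite_PiE)

lemma card_box_cells_le:
  assumes "t \<ge> 1"
  shows "real (card (box_cells t :: ('a::euclidean_space \<Rightarrow> int) set)) \<le> (4 * t) ^ DIM('a)"
proof -
  have "real (card {\<lfloor>- t\<rfloor>..\<lfloor>t\<rfloor>}) \<le> 4 * t"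
    using assms by simp linarith
  then have "real (card {\<lfloor>- t\<rfloor>..\<lfloor>t\<rfloor>}) ^ DIM('a) \<le> (4 * t) ^ DIM('a)"
    by (intro power_mono) auto
  then show ?thesis
    by (simp add: box_cells_def card_funcsetE)
qed

lemma cell_index_in_box_cells:
  fixes y :: "'a::euclidean_space"
  assumes "\<epsilon> > 0" "norm y \<le> t * \<epsilon>"
  shows "cell_index \<epsilon> y \<in> box_cells t"
  unfolding box_cells_def cell_index_def
proof (intro PiE_I)
  fix b :: 'a assume b: "b \<in> Basis"
  have "\<bar>(y \<bullet> b) / \<epsilon>\<bar> \<le> t"
    using Basis_le_norm[OF b, of y] assms by (simp add: pos_divide_le_eq)
  then have "- t \<le> (y \<bullet> b) / \<epsilon>" "(y \<bullet> b) / \<epsilon> \<le> t" by linarith+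
  then show "(\<lambda>b\<in>Basis. \<lfloor>(y \<bullet> b) / \<epsilon>\<rfloor>) b \<in> {\<lfloor>- t\<rfloor>..\<lfloor>t\<rfloor>}"
    using b by (auto intro!: floor_mono)
qed simp

lemma cell_corner_close:
  fixes y :: "'a::euclidean_space"
  assumes "\<epsilon> > 0" "b \<in> Basis"
  shows "\<bar>(y - cell_corner \<epsilon> (cell_index \<epsilon> y)) \<bullet> b\<bar> \<le> \<epsilon>"
proof -
  have "cell_corner \<epsilon> (cell_index \<epsilon> y) \<bullet> b = \<epsilon> * of_int \<lfloor>(y \<bullet> b) / \<epsilon>\<rfloor>"
    using assms(2) by (simp add: cell_corner_def cell_index_def)
  moreover have "\<epsilon> * of_int \<lfloor>(y \<bullet> b) / \<epsilon>\<rfloor> \<le> \<epsilon> * ((y \<bullet> b) / \<epsilon>)"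
    "\<epsilon> * ((y \<bullet> b) / \<epsilon>) \<le> \<epsilon> * (of_int \<lfloor>(y \<bullet> b) / \<epsilon>\<rfloor> + 1)"
    using assms(1) by (intro mult_left_mono; linarith)+
  ultimately show ?thesis
    using assms(1) by (simp add: inner_diff_left algebra_simps abs_le_iff)
qed

lemma measurable_cell_index_eq [measurable]:
  "{y::'a::euclidean_space. cell_index \<epsilon> y = k} \<in> sets borel"
proof (cases "k \<in> extensional Basis")
  case True
  then have "{y::'a. cell_index \<epsilon> y = k} = {y. \<forall>b\<in>Basis. \<lfloor>(y \<bullet> b) / \<epsilon>\<rfloor> = k b}"
    by (auto simp: cell_index_def intro!: extensionalityI[of _ Basis])
  moreover have "{y \<in> space borel. \<forall>b\<in>Basis. \<lfloor>((y::'a) \<bullet> b) / \<epsilon>\<rfloor> = k b} \<in> sets borel"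
    by measurable
  ultimately show ?thesis by simp
next
  case False
  then have "{y::'a. cell_index \<epsilon> y = k} = {}"
    by (auto simp: cell_index_def)
  then show ?thesis by simp
qed

text \<open>
  Inside the box the error is the oscillation on a cube, \<open>DIM('a) * \<epsilon>\<close>. Outside, the step function is
  zero and the error is at most 1; but there \<open>norm y\<close> exceeds the radius \<open>t * \<epsilon>\<close>, whose square is
  \<open>1 / \<epsilon>\<close>, so that \<open>\<epsilon> * (norm y)\<^sup>2\<close> is at least 1. The bound by the second moment takes care of both.
\<close>
lemma step_function_approximation:
  fixes \<phi> :: "'a::euclidean_space \<Rightarrow> real"
  assumes \<epsilon>: "\<epsilon> > 0" and t: "t * \<epsilon> > 0" "(t * \<epsilon>)\<^sup>2 * \<epsilon> = 1"
    and bound: "\<And>x. \<bar>\<phi> x\<bar> \<le> 1"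
    and Lip: "\<And>x y. \<bar>\<phi> y - \<phi> x\<bar> \<le> (\<Sum>b\<in>Basis. \<bar>(y - x) \<bullet> b\<bar>)"
  shows "\<bar>\<phi> y - (\<Sum>k\<in>box_cells t. \<phi> (cell_corner \<epsilon> k) * indicator {y. cell_index \<epsilon> y = k} y)\<bar>
    \<le> \<epsilon> * (real DIM('a) + (norm y)\<^sup>2)"
proof -
  have sum_eq: "(\<Sum>k\<in>box_cells t. \<phi> (cell_corner \<epsilon> k) * indicator {y. cell_index \<epsilon> y = k} y) =
      (if cell_index \<epsilon> y \<in> box_cells t then \<phi> (cell_corner \<epsilon> (cell_index \<epsilon> y)) else 0)"
    (is "?s = _")
  proof -
    have "?s = (\<Sum>k\<in>box_cells t. if k = cell_index \<epsilon> y then \<phi> (cell_corner \<epsilon> k) else 0)"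
      by (intro sum.cong) (auto simp: indicator_def)
    then show ?thesis by simp
  qed
  show ?thesis
  proof (cases "cell_index \<epsilon> y \<in> box_cells t")
    case True
    have "\<bar>\<phi> y - \<phi> (cell_corner \<epsilon> (cell_index \<epsilon> y))\<bar>
        \<le> (\<Sum>b\<in>Basis. \<bar>(y - cell_corner \<epsilon> (cell_index \<epsilon> y)) \<bullet> b\<bar>)"
      by (rule Lip)
    also have "\<dots> \<le> real DIM('a) * \<epsilon>"
      using cell_corner_close[OF \<epsilon>] by (intro sum_bounded_above)
    also have "\<dots> \<le> \<epsilon> * (real DIM('a) + (norm y)\<^sup>2)"
      using \<epsilon> by (simp add: algebra_simps)
    finally show ?thesis using True sum_eq by simp
  next
    case False
    then have "t * \<epsilon> < norm y"
      using cell_index_in_box_cells[OF \<epsilon>, of y t] by linarith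
    then have "(t * \<epsilon>)\<^sup>2 * \<epsilon> \<le> (norm y)\<^sup>2 * \<epsilon>"
      using t \<epsilon> by (intro mult_right_mono power_mono) auto
    then have "1 \<le> \<epsilon> * (norm y)\<^sup>2" using t by (simp add: mult.commute)
    also have "\<dots> \<le> \<epsilon> * (real DIM('a) + (norm y)\<^sup>2)"
      using \<epsilon> by (simp add: algebra_simps)
    finally show ?thesis using False sum_eq bound[of y] by simp
  qed
qed

section \<open>Expected flat distance\<close>

text \<open>
  One row of the triangular array: the particles for a single fixed \<open>N\<close>.
\<close>
locale weighted_particles = prob_space P for P :: "'w measure" +
  fixes N :: nat and X :: "nat \<Rightarrow> 'w \<Rightarrow> 'a::euclidean_space" and m :: "nat \<Rightarrow> 'w \<Rightarrow> real"
    and M C :: real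
  assumes N_pos: "N > 0"
    and X_meas: "\<And>i. i \<in> {1..N} \<Longrightarrow> X i \<in> borel_measurable P"
    and m_meas: "\<And>i. i \<in> {1..N} \<Longrightarrow> m i \<in> borel_measurable P"
    and m_nonneg: "\<And>i \<omega>. i \<in> {1..N} \<Longrightarrow> 0 \<le> m i \<omega>"
    and m_le: "\<And>i \<omega>. i \<in> {1..N} \<Longrightarrow> m i \<omega> \<le> M"
    and indep: "\<And>i j. i \<in> {1..N} \<Longrightarrow> j \<in> {1..N} \<Longrightarrow> i \<noteq> j \<Longrightarrow>
      indep_var (borel \<Otimes>\<^sub>M borel) (\<lambda>\<omega>. (X i \<omega>, m i \<omega>)) (borel \<Otimes>\<^sub>M borel) (\<lambda>\<omega>. (X j \<omega>, m j \<omega>))"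
    and moment_int: "\<And>i. i \<in> {1..N} \<Longrightarrow> integrable P (\<lambda>\<omega>. (norm (X i \<omega>))\<^sup>2)"
    and moment_le: "\<And>i. i \<in> {1..N} \<Longrightarrow> expectation (\<lambda>\<omega>. (norm (X i \<omega>))\<^sup>2) \<le> C"
begin

lemma M_nonneg: "0 \<le> M"
  using m_nonneg[of 1 undefined] m_le[of 1 undefined] N_pos by auto

definition cell_mass :: "real \<Rightarrow> ('a \<Rightarrow> int) \<Rightarrow> nat \<Rightarrow> 'w \<Rightarrow> real" where
  "cell_mass \<epsilon> k i \<omega> = m i \<omega> * indicator {y. cell_index \<epsilon> y = k} (X i \<omega>)"

definition fluctuation :: "real \<Rightarrow> ('a \<Rightarrow> int) \<Rightarrow> 'w \<Rightarrow> real" where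
  "fluctuation \<epsilon> k \<omega> = (\<Sum>i\<in>{1..N}. cell_mass \<epsilon> k i \<omega> - expectation (cell_mass \<epsilon> k i))"

definition approx_error :: "real \<Rightarrow> nat \<Rightarrow> 'w \<Rightarrow> real" where
  "approx_error \<epsilon> i \<omega> = M * (\<epsilon> * (real DIM('a) + (norm (X i \<omega>))\<^sup>2))"

lemma cell_mass_measurable: "i \<in> {1..N} \<Longrightarrow> cell_mass \<epsilon> k i \<in> borel_measurable P"
proof -
  assume i: "i \<in> {1..N}"
  have "(\<lambda>\<omega>. indicator {y. cell_index \<epsilon> y = k} (X i \<omega>) :: real) \<in> borel_measurable P"
    by (rule measurable_compose[OF X_meas[OF i]]) simp
  then show ?thesis
    unfolding cell_mass_def using m_meas[OF i] by (intro borel_measurable_times)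
qed

lemma cell_mass_bound: "i \<in> {1..N} \<Longrightarrow> \<bar>cell_mass \<epsilon> k i \<omega>\<bar> \<le> M"
  using m_nonneg[of i \<omega>] m_le[of i \<omega>] M_nonneg by (auto simp: cell_mass_def indicator_def)

lemma cell_mass_integrable: "i \<in> {1..N} \<Longrightarrow> integrable P (cell_mass \<epsilon> k i)"
  using cell_mass_measurable cell_mass_bound by (intro integrable_const_bound[where B = M]) auto

lemma cell_mass_indep:
  assumes "i \<in> {1..N}" "j \<in> {1..N}" "i \<noteq> j"
  shows "indep_var borel (cell_mass \<epsilon> k i) borel (cell_mass \<epsilon> k j)"
proof -
  let ?f = "\<lambda>(x, w). w * indicator {y. cell_index \<epsilon> y = k} x :: real"
  have "?f \<in> borel_measurable (borel \<Otimes>\<^sub>M borel)"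
    by measurable
  from indep_var_compose[OF indep[OF assms] this this]
  show ?thesis by (simp add: comp_def cell_mass_def[abs_def])
qed

lemma approx_error_integrable: "i \<in> {1..N} \<Longrightarrow> integrable P (approx_error \<epsilon> i)"
  unfolding approx_error_def using moment_int
  by (intro integrable_mult_right Bochner_Integration.integrable_add) auto

lemma expectation_approx_error_le:
  assumes "i \<in> {1..N}" "\<epsilon> > 0"
  shows "expectation (approx_error \<epsilon> i) \<le> M * (\<epsilon> * (real DIM('a) + C))"
proof -
  have "expectation (approx_error \<epsilon> i) = M * (\<epsilon> * (real DIM('a) + expectation (\<lambda>\<omega>. (norm (X i \<omega>))\<^sup>2)))"
    using moment_int[OF assms(1)] unfolding approx_error_def by (simp add: prob_space)
  also have "\<dots> \<le> M * (\<epsilon> * (real DIM('a) + C))"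
    using M_nonneg assms moment_le by (intro mult_left_mono add_left_mono) auto
  finally show ?thesis .
qed

text \<open>
  Replacing \<open>\<phi>\<close> by its step function costs the approximation error under both measures. For the
  step function, the difference of the integrals is a combination of the fluctuations of the cell
  masses with coefficients \<open>\<phi> (cell_corner \<epsilon> k)\<close> of modulus at most 1. The right-hand side does not
  mention \<open>\<phi>\<close>, so it bounds the flat distance pointwise in \<open>\<omega>\<close>.
\<close>
lemma integral_difference_le:
  fixes \<phi> :: "'a \<Rightarrow> real"
  assumes \<epsilon>: "\<epsilon> > 0" and t: "t * \<epsilon> > 0" "(t * \<epsilon>)\<^sup>2 * \<epsilon> = 1"
    and \<phi>: "\<phi> \<in> borel_measurable borel"
    and bound: "\<And>x. \<bar>\<phi> x\<bar> \<le> 1"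
    and Lip: "\<And>x y. \<bar>\<phi> y - \<phi> x\<bar> \<le> (\<Sum>b\<in>Basis. \<bar>(y - x) \<bullet> b\<bar>)"
  shows "\<bar>(\<integral>x. \<phi> x \<partial>empirical_measure N X m \<omega>) - (\<integral>x. \<phi> x \<partial>mean_measure P N X m)\<bar> \<le>
    ((\<Sum>k\<in>box_cells t. \<bar>fluctuation \<epsilon> k \<omega>\<bar>) +
      (\<Sum>i\<in>{1..N}. approx_error \<epsilon> i \<omega> + expectation (approx_error \<epsilon> i))) / real N"
proof -
  define s where "s i \<omega> = (\<Sum>k\<in>box_cells t. \<phi> (cell_corner \<epsilon> k) * cell_mass \<epsilon> k i \<omega>)" for i \<omega>
  define u where "u i \<omega> = m i \<omega> * \<phi> (X i \<omega>)" for i \<omega>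
  have close: "\<bar>u i \<omega> - s i \<omega>\<bar> \<le> approx_error \<epsilon> i \<omega>" if i: "i \<in> {1..N}" for i \<omega>
  proof -
    let ?r = "\<phi> (X i \<omega>) - (\<Sum>k\<in>box_cells t. \<phi> (cell_corner \<epsilon> k) * indicator {y. cell_index \<epsilon> y = k} (X i \<omega>))"
    have "u i \<omega> - s i \<omega> = m i \<omega> * ?r"
      unfolding u_def s_def cell_mass_def right_diff_distrib sum_distrib_left by (simp only: mult_ac)
    also have "\<bar>\<dots>\<bar> = m i \<omega> * \<bar>?r\<bar>"
      using m_nonneg[OF i] by (simp add: abs_mult)
    also have "\<dots> \<le> M * (\<epsilon> * (real DIM('a) + (norm (X i \<omega>))\<^sup>2))"
      using m_le[OF i] M_nonneg
      by (intro mult_mono step_function_approximation[OF \<epsilon> t bound Lip]) auto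
    finally show ?thesis by (simp add: approx_error_def)
  qed
  have u_int: "integrable P (u i)" if i: "i \<in> {1..N}" for i
  proof (rule integrable_const_bound[where B = M])
    show "u i \<in> borel_measurable P"
      unfolding u_def using m_meas[OF i] measurable_compose[OF X_meas[OF i] \<phi>]
      by (intro borel_measurable_times)
    have "\<bar>u i \<omega>\<bar> \<le> M" for \<omega>
      using mult_mono[OF m_le[OF i] bound[of "X i \<omega>"] M_nonneg abs_ge_zero] m_nonneg[OF i]
      by (simp add: u_def abs_mult)
    then show "AE \<omega> in P. norm (u i \<omega>) \<le> M" by simp
  qed
  have s_int: "integrable P (s i)" if i: "i \<in> {1..N}" for i
    unfolding s_def using cell_mass_integrable[OF i]
    by (intro Bochner_Integration.integrable_sum integrable_mult_right)
  have s_exp: "expectation (s i) = (\<Sum>k\<in>box_cells t. \<phi> (cell_corner \<epsilon> k) * expectation (cell_mass \<epsilon> k i))"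
    if i: "i \<in> {1..N}" for i
    unfolding s_def using cell_mass_integrable[OF i] by (subst Bochner_Integration.integral_sum) auto
  have exp_close: "\<bar>expectation (u i) - expectation (s i)\<bar> \<le> expectation (approx_error \<epsilon> i)"
    if i: "i \<in> {1..N}" for i
  proof -
    have "expectation (u i) - expectation (s i) = expectation (\<lambda>\<omega>. u i \<omega> - s i \<omega>)"
      using u_int[OF i] s_int[OF i] by simp
    also have "\<bar>\<dots>\<bar> \<le> expectation (approx_error \<epsilon> i)"
      using u_int[OF i] s_int[OF i] close[OF i] approx_error_integrable[OF i]
      by (intro order_trans[OF integral_abs_bound] integral_mono) auto
    finally show ?thesis .
  qed
  have "(\<Sum>i\<in>{1..N}. s i \<omega> - expectation (s i)) =
      (\<Sum>i\<in>{1..N}. \<Sum>k\<in>box_cells t. \<phi> (cell_corner \<epsilon> k) * (cell_mass \<epsilon> k i \<omega> - expectation (cell_mass \<epsilon> k i)))"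
    using s_exp by (intro sum.cong refl) (simp add: s_def right_diff_distrib sum_subtractf)
  also have "\<dots> = (\<Sum>k\<in>box_cells t. \<phi> (cell_corner \<epsilon> k) * fluctuation \<epsilon> k \<omega>)"
    by (subst sum.swap) (simp add: fluctuation_def sum_distrib_left)
  also have "\<bar>\<dots>\<bar> \<le> (\<Sum>k\<in>box_cells t. \<bar>fluctuation \<epsilon> k \<omega>\<bar>)"
    using bound
    by (intro order_trans[OF sum_abs] sum_mono) (simp add: abs_mult mult_left_le_one_le)
  finally have step: "\<bar>\<Sum>i\<in>{1..N}. s i \<omega> - expectation (s i)\<bar> \<le> (\<Sum>k\<in>box_cells t. \<bar>fluctuation \<epsilon> k \<omega>\<bar>)" .
  have "\<bar>(\<Sum>i\<in>{1..N}. u i \<omega> - expectation (u i)) - (\<Sum>i\<in>{1..N}. s i \<omega> - expectation (s i))\<bar> \<le>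
      (\<Sum>i\<in>{1..N}. approx_error \<epsilon> i \<omega> + expectation (approx_error \<epsilon> i))"
    unfolding sum_subtractf[symmetric]
  proof (intro order_trans[OF sum_abs] sum_mono)
    fix i assume i: "i \<in> {1..N}"
    show "\<bar>u i \<omega> - expectation (u i) - (s i \<omega> - expectation (s i))\<bar> \<le>
        approx_error \<epsilon> i \<omega> + expectation (approx_error \<epsilon> i)"
      using close[OF i, of \<omega>] exp_close[OF i] by linarith
  qed
  with step have "\<bar>\<Sum>i\<in>{1..N}. u i \<omega> - expectation (u i)\<bar> \<le> (\<Sum>k\<in>box_cells t. \<bar>fluctuation \<epsilon> k \<omega>\<bar>) +
      (\<Sum>i\<in>{1..N}. approx_error \<epsilon> i \<omega> + expectation (approx_error \<epsilon> i))"
    by linarith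
  moreover have "(\<integral>x. \<phi> x \<partial>empirical_measure N X m \<omega>) = (\<Sum>i\<in>{1..N}. u i \<omega>) / real N"
    unfolding u_def using m_nonneg by (intro integral_empirical_measure[OF \<phi>])
  moreover have "(\<integral>x. \<phi> x \<partial>mean_measure P N X m) = (\<Sum>i\<in>{1..N}. expectation (u i)) / real N"
    unfolding u_def using u_int
    by (intro integral_mean_measure[OF \<phi> X_meas m_meas m_nonneg]) (simp_all only: u_def[abs_def])
  ultimately show ?thesis
    by (simp add: diff_divide_distrib[symmetric] sum_subtractf divide_right_mono)
qed

text \<open>
  A particle lies in one cell only, so for each \<open>i\<close> at most one of the cell masses is nonzero, and
  their squares add up to at most \<open>M\<^sup>2\<close>, whatever the number of cells.
\<close>
lemma second_moment_fluctuations_le: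
  "(\<Sum>k\<in>box_cells t. expectation (\<lambda>\<omega>. (fluctuation \<epsilon> k \<omega>)\<^sup>2)) \<le> real N * M\<^sup>2"
proof -
  have sq_int: "integrable P (\<lambda>\<omega>. (cell_mass \<epsilon> k i \<omega>)\<^sup>2)" if i: "i \<in> {1..N}" for k i
    using cell_mass_measurable[OF i] cell_mass_bound[OF i] M_nonneg
    by (intro integrable_const_bound[where B = "M\<^sup>2"]) (auto simp: power_mono abs_le_square_iff[symmetric])
  have "(\<Sum>k\<in>box_cells t. expectation (\<lambda>\<omega>. (fluctuation \<epsilon> k \<omega>)\<^sup>2)) \<le>
      (\<Sum>k\<in>box_cells t. \<Sum>i\<in>{1..N}. expectation (\<lambda>\<omega>. (cell_mass \<epsilon> k i \<omega>)\<^sup>2))"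
    unfolding fluctuation_def
    by (intro sum_mono second_moment_sum_centered_le(2)[where B = M]
        cell_mass_measurable cell_mass_bound cell_mass_indep) auto
  also have "\<dots> = (\<Sum>i\<in>{1..N}. expectation (\<lambda>\<omega>. \<Sum>k\<in>box_cells t. (cell_mass \<epsilon> k i \<omega>)\<^sup>2))"
    using sq_int by (subst sum.swap) (simp add: Bochner_Integration.integral_sum)
  also have "\<dots> \<le> (\<Sum>i\<in>{1..N}. M\<^sup>2)"
  proof (intro sum_mono)
    fix i assume i: "i \<in> {1..N}"
    have "(\<Sum>k\<in>box_cells t. (cell_mass \<epsilon> k i \<omega>)\<^sup>2) \<le> M\<^sup>2" for \<omega>
    proof -
      have "(\<Sum>k\<in>box_cells t. (cell_mass \<epsilon> k i \<omega>)\<^sup>2) =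
          (\<Sum>k\<in>box_cells t. if k = cell_index \<epsilon> (X i \<omega>) then (m i \<omega>)\<^sup>2 else 0)"
        by (intro sum.cong) (auto simp: cell_mass_def indicator_def)
      also have "\<dots> \<le> (m i \<omega>)\<^sup>2" by simp
      also have "\<dots> \<le> M\<^sup>2" using m_nonneg[OF i] m_le[OF i] by (intro power_mono)
      finally show ?thesis .
    qed
    then have "expectation (\<lambda>\<omega>. \<Sum>k\<in>box_cells t. (cell_mass \<epsilon> k i \<omega>)\<^sup>2) \<le> expectation (\<lambda>\<omega>. M\<^sup>2)"
      using sq_int[OF i] by (intro integral_mono Bochner_Integration.integrable_sum) auto
    then show "expectation (\<lambda>\<omega>. \<Sum>k\<in>box_cells t. (cell_mass \<epsilon> k i \<omega>)\<^sup>2) \<le> M\<^sup>2"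
      by (simp add: prob_space)
  qed
  finally show ?thesis by simp
qed

text \<open>
  The absolute values of the fluctuations are traded for their squares by
  \<open>\<bar>z\<bar> \<le> (\<epsilon> * z\<^sup>2 + 1 / \<epsilon>) / 2\<close>. The weight \<open>\<epsilon>\<close> is chosen so that the squares, of total
  expectation at most \<open>N * M\<^sup>2\<close>, contribute a term of order \<open>\<epsilon>\<close> after division by \<open>N\<close>; the constant
  \<open>1 / \<epsilon>\<close> is paid once per cell.
\<close>
lemma expected_flat_dist_le:
  assumes \<epsilon>: "\<epsilon> > 0" and t: "t * \<epsilon> > 0" "(t * \<epsilon>)\<^sup>2 * \<epsilon> = 1" "t \<ge> 1"
  shows "(\<integral>\<^sup>+\<omega>. flat_dist (empirical_measure N X m \<omega>) (mean_measure P N X m) \<partial>P) \<le>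
    ennreal (\<epsilon> * M\<^sup>2 / 2 + (4 * t) ^ DIM('a) / (2 * \<epsilon> * real N) + 2 * M * (\<epsilon> * (real DIM('a) + C)))"
proof -
  define F where "F \<omega> = ((\<Sum>k\<in>box_cells t. \<bar>fluctuation \<epsilon> k \<omega>\<bar>) +
      (\<Sum>i\<in>{1..N}. approx_error \<epsilon> i \<omega> + expectation (approx_error \<epsilon> i))) / real N" for \<omega>
  define G where "G \<omega> = ((\<Sum>k\<in>box_cells t. (\<epsilon> * (fluctuation \<epsilon> k \<omega>)\<^sup>2 + 1 / \<epsilon>) / 2) +
      (\<Sum>i\<in>{1..N}. approx_error \<epsilon> i \<omega> + expectation (approx_error \<epsilon> i))) / real N" for \<omega>
  have "flat_dist (empirical_measure N X m \<omega>) (mean_measure P N X m) \<le> ennreal (F \<omega>)" for \<omega>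
    unfolding flat_dist_def
  proof (rule SUP_least)
    fix \<phi> :: "'a \<Rightarrow> real"
    assume "\<phi> \<in> {\<phi> \<in> W1inf. continuous_on UNIV \<phi> \<and> Linf_norm \<phi> \<le> 1 \<and>
               (\<exists>g. weak_gradient \<phi> g \<and> Linf_norm g \<le> 1)}"
    then obtain g where cont: "continuous_on UNIV \<phi>" and le: "Linf_norm \<phi> \<le> 1"
      and wg: "weak_gradient \<phi> g" and g: "Linf_norm g \<le> 1" by auto
    show "ennreal \<bar>(\<integral>x. \<phi> x \<partial>empirical_measure N X m \<omega>) - (\<integral>x. \<phi> x \<partial>mean_measure P N X m)\<bar> \<le> ennreal (F \<omega>)"
      unfolding F_def
      by (intro ennreal_leI integral_difference_le[OF \<epsilon> t(1,2)] borel_measurable_continuous_onI cont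
          Linf_norm_le_1_continuous[OF cont le]
          weak_gradient_bound_imp_Lipschitz[OF cont wg Linf_norm_le_1_AE[OF g]])
  qed
  also have "F \<omega> \<le> G \<omega>" for \<omega>
  proof -
    have "\<bar>z\<bar> \<le> (\<epsilon> * z\<^sup>2 + 1 / \<epsilon>) / 2" for z :: real
    proof -
      have "0 \<le> (\<epsilon> * \<bar>z\<bar> - 1)\<^sup>2 / \<epsilon>" using \<epsilon> by simp
      also have "\<dots> = \<epsilon> * z\<^sup>2 + 1 / \<epsilon> - 2 * \<bar>z\<bar>"
        using \<epsilon> by (simp add: power2_eq_square field_simps)
      finally show ?thesis by simp
    qed
    then show ?thesis
      unfolding F_def G_def by (intro divide_right_mono add_right_mono sum_mono) auto
  qed
  finally have dist_le: "flat_dist (empirical_measure N X m \<omega>) (mean_measure P N X m) \<le> ennreal (G \<omega>)" for \<omega>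
    by (simp add: ennreal_leI)
  have fluct_int: "integrable P (\<lambda>\<omega>. (fluctuation \<epsilon> k \<omega>)\<^sup>2)" for k
    unfolding fluctuation_def
    by (intro second_moment_sum_centered_le(1)[where B = M]
        cell_mass_measurable cell_mass_bound cell_mass_indep) auto
  have fluct_int': "integrable P (\<lambda>\<omega>. (\<epsilon> * (fluctuation \<epsilon> k \<omega>)\<^sup>2 + 1 / \<epsilon>) / 2)" for k
    using fluct_int by auto
  have err_int: "integrable P (\<lambda>\<omega>. approx_error \<epsilon> i \<omega> + expectation (approx_error \<epsilon> i))"
    if "i \<in> {1..N}" for i
    using approx_error_integrable[OF that] by auto
  have G_int: "integrable P G"
    unfolding G_def
    by (intro Bochner_Integration.integrable_add integrable_divide Bochner_Integration.integrable_sum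
        fluct_int' err_int)
  have G_nonneg: "0 \<le> G \<omega>" for \<omega>
    unfolding G_def using \<epsilon> M_nonneg
    by (intro divide_nonneg_nonneg add_nonneg_nonneg sum_nonneg integral_nonneg_AE)
       (auto simp: approx_error_def)
  have "expectation G = ((\<Sum>k\<in>box_cells t. (\<epsilon> * expectation (\<lambda>\<omega>. (fluctuation \<epsilon> k \<omega>)\<^sup>2) + 1 / \<epsilon>) / 2) +
      (\<Sum>i\<in>{1..N}. 2 * expectation (approx_error \<epsilon> i))) / real N"
  proof -
    have "expectation G = (expectation (\<lambda>\<omega>. \<Sum>k\<in>box_cells t. (\<epsilon> * (fluctuation \<epsilon> k \<omega>)\<^sup>2 + 1 / \<epsilon>) / 2) +
        expectation (\<lambda>\<omega>. \<Sum>i\<in>{1..N}. approx_error \<epsilon> i \<omega> + expectation (approx_error \<epsilon> i))) / real N"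
      unfolding G_def integral_divide_zero
      by (simp only: Bochner_Integration.integral_add[OF Bochner_Integration.integrable_sum[OF fluct_int']
            Bochner_Integration.integrable_sum[OF err_int]])
    also have "expectation (\<lambda>\<omega>. \<Sum>k\<in>box_cells t. (\<epsilon> * (fluctuation \<epsilon> k \<omega>)\<^sup>2 + 1 / \<epsilon>) / 2) =
        (\<Sum>k\<in>box_cells t. (\<epsilon> * expectation (\<lambda>\<omega>. (fluctuation \<epsilon> k \<omega>)\<^sup>2) + 1 / \<epsilon>) / 2)"
      using fluct_int by (subst Bochner_Integration.integral_sum[OF fluct_int']) (simp add: prob_space)
    also have "expectation (\<lambda>\<omega>. \<Sum>i\<in>{1..N}. approx_error \<epsilon> i \<omega> + expectation (approx_error \<epsilon> i)) =
        (\<Sum>i\<in>{1..N}. 2 * expectation (approx_error \<epsilon> i))"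
    proof (subst Bochner_Integration.integral_sum[OF err_int], assumption, intro sum.cong refl)
      fix i assume i: "i \<in> {1..N}"
      show "expectation (\<lambda>\<omega>. approx_error \<epsilon> i \<omega> + expectation (approx_error \<epsilon> i)) =
          2 * expectation (approx_error \<epsilon> i)"
        using approx_error_integrable[OF i] by (simp add: prob_space)
    qed
    finally show ?thesis .
  qed
  also have "(\<Sum>k\<in>box_cells t. (\<epsilon> * expectation (\<lambda>\<omega>. (fluctuation \<epsilon> k \<omega>)\<^sup>2) + 1 / \<epsilon>) / 2) =
      (\<epsilon> * (\<Sum>k\<in>box_cells t. expectation (\<lambda>\<omega>. (fluctuation \<epsilon> k \<omega>)\<^sup>2)) +
        real (card (box_cells t :: ('a \<Rightarrow> int) set)) / \<epsilon>) / 2"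
    by (simp add: sum_divide_distrib[symmetric] sum.distrib sum_distrib_left)
  also have "((\<epsilon> * (\<Sum>k\<in>box_cells t. expectation (\<lambda>\<omega>. (fluctuation \<epsilon> k \<omega>)\<^sup>2)) +
        real (card (box_cells t :: ('a \<Rightarrow> int) set)) / \<epsilon>) / 2
        + (\<Sum>i\<in>{1..N}. 2 * expectation (approx_error \<epsilon> i))) / real N \<le>
      ((\<epsilon> * (real N * M\<^sup>2) + (4 * t) ^ DIM('a) / \<epsilon>) / 2
        + (\<Sum>i\<in>{1..N}. 2 * (M * (\<epsilon> * (real DIM('a) + C))))) / real N"
    using \<epsilon> t(3)
    by (intro divide_right_mono add_mono mult_left_mono second_moment_fluctuations_le
        card_box_cells_le sum_mono expectation_approx_error_le) auto
  also have "\<dots> = \<epsilon> * M\<^sup>2 / 2 + (4 * t) ^ DIM('a) / (2 * \<epsilon> * real N) + 2 * M * (\<epsilon> * (real DIM('a) + C))"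
    using N_pos \<epsilon> by (simp add: field_simps)
  finally have G_le: "expectation G \<le> \<epsilon> * M\<^sup>2 / 2 + (4 * t) ^ DIM('a) / (2 * \<epsilon> * real N) + 2 * M * (\<epsilon> * (real DIM('a) + C))" .
  have "(\<integral>\<^sup>+\<omega>. flat_dist (empirical_measure N X m \<omega>) (mean_measure P N X m) \<partial>P) \<le> (\<integral>\<^sup>+\<omega>. ennreal (G \<omega>) \<partial>P)"
    using dist_le by (intro nn_integral_mono)
  also have "\<dots> = ennreal (expectation G)"
    using G_int G_nonneg by (intro nn_integral_eq_integral) auto
  also have "\<dots> \<le> ennreal (\<epsilon> * M\<^sup>2 / 2 + (4 * t) ^ DIM('a) / (2 * \<epsilon> * real N) + 2 * M * (\<epsilon> * (real DIM('a) + C)))"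
    using G_le by (rule ennreal_leI)
  finally show ?thesis .
qed

text \<open>
  With \<open>\<epsilon> = N powr (- a)\<close> the radius \<open>t * \<epsilon>\<close> has to be \<open>N powr (a / 2)\<close>, which determines \<open>t\<close>. The
  exponent \<open>a\<close> solves \<open>a * (2 + 3 * d / 2) = 1\<close>, and this is what makes the cell count
  \<open>t ^ d\<close> equal to \<open>\<epsilon>\<^sup>2 * N\<close>, so that its contribution is again of order \<open>\<epsilon>\<close>.
\<close>
lemma expected_flat_dist_rate:
  defines "a \<equiv> 1 / (2 + 3 * real DIM('a) / 2)"
  shows "(\<integral>\<^sup>+\<omega>. flat_dist (empirical_measure N X m \<omega>) (mean_measure P N X m) \<partial>P) \<le>
    ennreal ((M\<^sup>2 / 2 + 4 ^ DIM('a) / 2 + 2 * M * (real DIM('a) + C)) * real N powr (- a))"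
proof -
  define \<epsilon> where "\<epsilon> = real N powr (- a)"
  define t where "t = real N powr (3 / 2 * a)"
  have N: "real N > 0" "real N \<ge> 1" using N_pos by auto
  have a: "a > 0" "a * (2 + 3 * real DIM('a) / 2) = 1"
    by (auto simp: a_def add_pos_nonneg)
  have \<epsilon>: "\<epsilon> > 0" using N by (simp add: \<epsilon>_def)
  have t: "t \<ge> 1" using N a by (simp add: t_def ge_one_powr_ge_zero)
  have "t * \<epsilon> = real N powr (a / 2)"
    by (simp add: t_def \<epsilon>_def powr_add[symmetric])
  then have te: "t * \<epsilon> > 0" "(t * \<epsilon>)\<^sup>2 * \<epsilon> = 1"
    using N by (auto simp: \<epsilon>_def power2_eq_square powr_add[symmetric])
  have "t ^ DIM('a) = real N powr (3 / 2 * a * real DIM('a))"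
    using N by (simp add: t_def powr_powr powr_realpow[symmetric])
  also have "3 / 2 * a * real DIM('a) = - a + (- a + 1)"
    using a(2) by (simp add: algebra_simps)
  also have "real N powr \<dots> = \<epsilon> * \<epsilon> * real N"
    using N by (simp only: powr_add \<epsilon>_def powr_one mult.assoc)
  finally have "(4 * t) ^ DIM('a) / (2 * \<epsilon> * real N) = 4 ^ DIM('a) / 2 * \<epsilon>"
    using N \<epsilon> by (simp add: power_mult_distrib field_simps)
  then have "\<epsilon> * M\<^sup>2 / 2 + (4 * t) ^ DIM('a) / (2 * \<epsilon> * real N) + 2 * M * (\<epsilon> * (real DIM('a) + C)) =
      (M\<^sup>2 / 2 + 4 ^ DIM('a) / 2 + 2 * M * (real DIM('a) + C)) * \<epsilon>"
    by (simp add: algebra_simps)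
  then show ?thesis
    using expected_flat_dist_le[OF \<epsilon> te t] by (simp add: \<epsilon>_def)
qed

end

theorem lemma5:
  fixes M C :: real
  assumes "M > 0"
  shows "\<exists>Cbar>0. \<forall>(P :: (real ^ 'd::finite) measure)
           (X :: nat \<Rightarrow> nat \<Rightarrow> real ^ 'd \<Rightarrow> real ^ 'd)
           (m :: nat \<Rightarrow> nat \<Rightarrow> real ^ 'd \<Rightarrow> real) (mbar :: real).
           prob_space P \<and> sets P = sets borel \<and> mbar > 0 \<and>
           (\<forall>N\<ge>1. \<forall>i\<in>{1..N}. X N i \<in> borel_measurable P \<and> m N i \<in> borel_measurable P \<and>
              (\<forall>\<omega>. 0 \<le> m N i \<omega>)) \<and>
           (\<forall>N\<ge>1. \<forall>i\<in>{1..N}. \<forall>j\<in>{1..N}. i \<noteq> j \<longrightarrow>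
              prob_space.indep_var P
                (borel \<Otimes>\<^sub>M borel) (\<lambda>\<omega>. (X N i \<omega>, m N i \<omega>))
                (borel \<Otimes>\<^sub>M borel) (\<lambda>\<omega>. (X N j \<omega>, m N j \<omega>))) \<and>
           (\<forall>N\<ge>1. \<forall>i\<in>{1..N}. integrable P (\<lambda>\<omega>. (norm (X N i \<omega>))\<^sup>2) \<and>
              prob_space.expectation P (\<lambda>\<omega>. (norm (X N i \<omega>))\<^sup>2) \<le> C) \<and>
           (\<forall>N\<ge>1. \<forall>i\<in>{1..N}. \<forall>\<omega>. \<bar>m N i \<omega>\<bar> \<le> M) \<and>
           (\<forall>N\<ge>1. \<forall>i\<in>{1..N}. prob_space.expectation P (m N i) \<ge> mbar)
           \<longrightarrow>
           (\<forall>N::nat. real N > max 1 (mbar powr (- 1 / (2 + 3 * real CARD('d) / 2))) \<longrightarrow>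
              (\<lambda>\<omega>. flat_dist (empirical_measure N (X N) (m N) \<omega>) (mean_measure P N (X N) (m N)))
                \<in> borel_measurable P \<and>
              (\<integral>\<^sup>+\<omega>. flat_dist (empirical_measure N (X N) (m N) \<omega>)
                                (mean_measure P N (X N) (m N)) \<partial>P)
                \<le> ennreal (Cbar * real N powr (- 1 / (2 + 3 * real CARD('d) / 2))))"
proof (intro exI[of _ "M\<^sup>2 / 2 + 4 ^ CARD('d) / 2 + 2 * M * (real CARD('d) + \<bar>C\<bar>)"] conjI allI impI)
  show "0 < M\<^sup>2 / 2 + 4 ^ CARD('d) / 2 + 2 * M * (real CARD('d) + \<bar>C\<bar>)"
    using assms by (intro add_pos_nonneg) auto
next
  fix P :: "(real ^ 'd) measure" and X :: "nat \<Rightarrow> nat \<Rightarrow> real ^ 'd \<Rightarrow> real ^ 'd"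
    and m :: "nat \<Rightarrow> nat \<Rightarrow> real ^ 'd \<Rightarrow> real" and mbar :: real and N :: nat
  assume hyp: "prob_space P \<and> sets P = sets borel \<and> mbar > 0 \<and>
           (\<forall>N\<ge>1. \<forall>i\<in>{1..N}. X N i \<in> borel_measurable P \<and> m N i \<in> borel_measurable P \<and>
              (\<forall>\<omega>. 0 \<le> m N i \<omega>)) \<and>
           (\<forall>N\<ge>1. \<forall>i\<in>{1..N}. \<forall>j\<in>{1..N}. i \<noteq> j \<longrightarrow>
              prob_space.indep_var P
                (borel \<Otimes>\<^sub>M borel) (\<lambda>\<omega>. (X N i \<omega>, m N i \<omega>))
                (borel \<Otimes>\<^sub>M borel) (\<lambda>\<omega>. (X N j \<omega>, m N j \<omega>))) \<and>
           (\<forall>N\<ge>1. \<forall>i\<in>{1..N}. integrable P (\<lambda>\<omega>. (norm (X N i \<omega>))\<^sup>2) \<and>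
              prob_space.expectation P (\<lambda>\<omega>. (norm (X N i \<omega>))\<^sup>2) \<le> C) \<and>
           (\<forall>N\<ge>1. \<forall>i\<in>{1..N}. \<forall>\<omega>. \<bar>m N i \<omega>\<bar> \<le> M) \<and>
           (\<forall>N\<ge>1. \<forall>i\<in>{1..N}. prob_space.expectation P (m N i) \<ge> mbar)"
    and N: "real N > max 1 (mbar powr (- 1 / (2 + 3 * real CARD('d) / 2)))"
  have N1: "N \<ge> 1" using N by simp
  interpret prob_space P using hyp by blast
  have props: "\<And>i. i \<in> {1..N} \<Longrightarrow> X N i \<in> borel_measurable P"
    "\<And>i. i \<in> {1..N} \<Longrightarrow> m N i \<in> borel_measurable P"
    "\<And>i \<omega>. i \<in> {1..N} \<Longrightarrow> 0 \<le> m N i \<omega>"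
    "\<And>i \<omega>. i \<in> {1..N} \<Longrightarrow> \<bar>m N i \<omega>\<bar> \<le> M"
    "\<And>i j. i \<in> {1..N} \<Longrightarrow> j \<in> {1..N} \<Longrightarrow> i \<noteq> j \<Longrightarrow>
      indep_var (borel \<Otimes>\<^sub>M borel) (\<lambda>\<omega>. (X N i \<omega>, m N i \<omega>)) (borel \<Otimes>\<^sub>M borel) (\<lambda>\<omega>. (X N j \<omega>, m N j \<omega>))"
    "\<And>i. i \<in> {1..N} \<Longrightarrow> integrable P (\<lambda>\<omega>. (norm (X N i \<omega>))\<^sup>2)"
    "\<And>i. i \<in> {1..N} \<Longrightarrow> expectation (\<lambda>\<omega>. (norm (X N i \<omega>))\<^sup>2) \<le> C"
    using hyp N1 by blast+
  show "(\<lambda>\<omega>. flat_dist (empirical_measure N (X N) (m N) \<omega>) (mean_measure P N (X N) (m N)))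
      \<in> borel_measurable P"
    using props by (intro borel_measurable_flat_dist) auto
  interpret weighted_particles P N "X N" "m N" M "\<bar>C\<bar>"
  proof
    fix i \<omega> assume i: "i \<in> {1..N}"
    show "m N i \<omega> \<le> M" using props(4)[OF i, of \<omega>] by simp
    show "expectation (\<lambda>\<omega>. (norm (X N i \<omega>))\<^sup>2) \<le> \<bar>C\<bar>" using props(7)[OF i] by simp
  qed (use N1 props in auto)
  show "(\<integral>\<^sup>+\<omega>. flat_dist (empirical_measure N (X N) (m N) \<omega>) (mean_measure P N (X N) (m N)) \<partial>P)
      \<le> ennreal ((M\<^sup>2 / 2 + 4 ^ CARD('d) / 2 + 2 * M * (real CARD('d) + \<bar>C\<bar>))
          * real N powr (- 1 / (2 + 3 * real CARD('d) / 2)))"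
    using expected_flat_dist_rate by simp
qed

end
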